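(* Let $k$ be a field, let $r \geq 3$ and $d \geq 2$ be integers, and let $R = k[E(G_{r,d})]$. Then the Hilbert series of $R/I_{G_{r,d}}$ is \[HS_{R/I_{G_{r,d}}}(t) = \frac{1+dt+dt^2+\cdots+dt^{r-1}}{(1-t)^{d+2r-2}}.\] In particular, the $h$-vector of $R/I_{G_{r,d}}$ is $(1,d,\ldots,d)$ (with $d$ appearing $r-1$ times).
   Context: For a finite simple graph $G$ with vertices $V(G)$ and edges $E(G)$, let $k[V(G)]$ and $k[E(G)]$ be the polynomial rings over a field $k$ whose variables are the vertices, respectively the edges, of $G$. The toric ideal $I_G \subseteq k[E(G)]$ is the kernel of the $k$-algebra homomorphism $\phi_G: k[E(G)] \to k[V(G)]$ sending the variable of each edge $e=\{x,x'\}$ to $x x'$. The ring $k[E(G)]$ is standard graded. For integers $r\geq 3$, $d \geq 2$, the graph $G_{r,d}$ has vertex set $\{x_1,x_2,y_1,\ldots,y_d,z_1,\ldots,z_{2r-3}\}$ and edges: $a_i=\{x_1,y_i\}$ and $b_i=\{x_2,y_i\}$ for $1\leq i\leq d$; $e_1=\{x_1,z_1\}$; $e_i=\{z_{i-1},z_i\}$ for $2\leq i\leq 2r-3$; and $e_{2r-2}=\{z_{2r-3},x_2\}$. For a homogeneous ideal $I$ of a standard graded polynomial ring $S$ over $k$, the Hilbert series of $S/I$ is $HS_{S/I}(t)=\sum_{i\geq 0}\dim_k (S/I)_i\,t^i = \frac{Q(t)}{(1-t)^{D}}$ with $Q(t)\in\mathbb{Z}[t]$ and $D=\dim S/I$ the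 Krull dimension. If $Q(t)=h_0+h_1t+\cdots+h_mt^m$, the $h$-vector of $S/I$ is $(h_0,\ldots,h_m)$. *)

theory Defs
  imports
    "HOL-Library.Poly_Mapping"
    "HOL-Library.Extended_Nat"
    "HOL-Algebra.Embedded_Algebras"
    "HOL-Algebra.QuotRing"
    "HOL-Computational_Algebra.Polynomial_FPS"
begin

section \<open>Polynomial rings\<close>

text \<open>
  Monomials over a type of indeterminates are finitely supported exponent functions, and polynomials
  are finitely supported coefficient functions on monomials. The type provides every element of
  \<open>'x\<close> as an indeterminate; the polynomial ring in a given set \<open>A\<close> of indeterminates is carved out
  as a carrier set.
\<close>

type_synonym ('x, 'k) mpoly = "('x \<Rightarrow>\<^sub>0 nat) \<Rightarrow>\<^sub>0 'k"

definition mpolys :: "'x set \<Rightarrow> ('x, 'k::zero) mpoly set" where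
  "mpolys A = {p. \<forall>m \<in> Poly_Mapping.keys p. Poly_Mapping.keys m \<subseteq> A}"

definition mpoly_ring :: "'x set \<Rightarrow> ('x, 'k::comm_ring_1) mpoly ring" where
  "mpoly_ring A = \<lparr>carrier = mpolys A, monoid.mult = (*), one = 1, zero = 0, add = (+)\<rparr>"

abbreviation mpoly_const :: "'k::zero \<Rightarrow> ('x, 'k) mpoly" where
  "mpoly_const c \<equiv> Poly_Mapping.single 0 c"

abbreviation mpoly_var :: "'x \<Rightarrow> ('x, 'k::zero_neq_one) mpoly" where
  "mpoly_var x \<equiv> Poly_Mapping.single (Poly_Mapping.single x 1) 1"

definition monom_degree :: "('x \<Rightarrow>\<^sub>0 nat) \<Rightarrow> nat" where
  "monom_degree m = (\<Sum>x\<in>Poly_Mapping.keys m. Poly_Mapping.lookup m x)"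

definition mpoly_forms :: "'x set \<Rightarrow> nat \<Rightarrow> ('x, 'k::zero) mpoly set" where
  "mpoly_forms A i = {p \<in> mpolys A. \<forall>m \<in> Poly_Mapping.keys p. monom_degree m = i}"

text \<open>The algebra homomorphism sending each indeterminate \<open>x\<close> to \<open>f x\<close>.\<close>

definition mpoly_subst ::
    "('x \<Rightarrow> ('y, 'k) mpoly) \<Rightarrow> ('x, 'k) mpoly \<Rightarrow> ('y, 'k::comm_ring_1) mpoly" where
  "mpoly_subst f p =
     (\<Sum>m\<in>Poly_Mapping.keys p. mpoly_const (Poly_Mapping.lookup p m) *
        (\<Prod>x\<in>Poly_Mapping.keys m. f x ^ Poly_Mapping.lookup m x))"


section \<open>Krull dimension, Hilbert series and h-vector\<close>

text \<open>The supremum is \<open>0\<close> for the zero ring, which has no prime ideals.\<close>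

definition krull_dim :: "('a, 'b) ring_scheme \<Rightarrow> enat" where
  "krull_dim R =
     Sup {enat n |n. \<exists>P. (\<forall>i\<le>n. primeideal (P i) R) \<and> (\<forall>i<n. P i \<subset> P (Suc i))}"

text \<open>
  For an ideal \<open>I\<close> of the polynomial ring \<open>S\<close> in the indeterminates \<open>A\<close>, the degree \<open>i\<close> component of
  \<open>S/I\<close> is the image of the forms of degree \<open>i\<close>, and \<open>k\<close> acts on \<open>S/I\<close> through the image of the
  constant polynomials. The notions below are meant for proper homogeneous \<open>I\<close>; for these
  \<open>S/I\<close> is the direct sum of the components, and \<open>k\<close> is embedded in \<open>S/I\<close> as a subfield.
\<close>

definition quot_const :: "'x set \<Rightarrow> ('x, 'k::field) mpoly set \<Rightarrow> ('x, 'k) mpoly set set" where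
  "quot_const A I = (\<lambda>c. I +>\<^bsub>mpoly_ring A\<^esub> mpoly_const c) ` UNIV"

definition quot_component ::
    "'x set \<Rightarrow> ('x, 'k::field) mpoly set \<Rightarrow> nat \<Rightarrow> ('x, 'k) mpoly set set" where
  "quot_component A I i = (\<lambda>p. I +>\<^bsub>mpoly_ring A\<^esub> p) ` mpoly_forms A i"

definition hilbert_series :: "'x set \<Rightarrow> ('x, 'k::field) mpoly set \<Rightarrow> rat fps" where
  "hilbert_series A I =
     Abs_fps (\<lambda>i. of_nat (ring.dim (mpoly_ring A Quot I) (quot_const A I) (quot_component A I i)))"

text \<open>Note that \<open>coeffs\<close> lists the coefficients by increasing degree, up to the leading one.\<close>

definition is_h_vector :: "'x set \<Rightarrow> ('x, 'k::field) mpoly set \<Rightarrow> int list \<Rightarrow> bool" where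
  "is_h_vector A I h \<longleftrightarrow>
     (\<exists>(Q :: int poly) (D :: nat).
        krull_dim (mpoly_ring A Quot I) = enat D \<and>
        hilbert_series A I = fps_of_poly (map_poly of_int Q) / (1 - fps_X) ^ D \<and>
        h = coeffs Q)"


section \<open>Toric ideals of graphs\<close>

record 'v ugraph =
  verts :: "'v set"
  edges :: "'v set set"

definition finite_simple_graph :: "'v ugraph \<Rightarrow> bool" where
  "finite_simple_graph G \<longleftrightarrow>
     finite (verts G) \<and> (\<forall>e \<in> edges G. e \<subseteq> verts G \<and> card e = 2)"

definition toric_map :: "('v set, 'k) mpoly \<Rightarrow> ('v, 'k::field) mpoly" where
  "toric_map = mpoly_subst (\<lambda>e. \<Prod>v\<in>e. mpoly_var v)"

definition toric_ideal :: "'v ugraph \<Rightarrow> ('v set, 'k::field) mpoly set" where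
  "toric_ideal G = a_kernel (mpoly_ring (edges G)) (mpoly_ring (verts G)) toric_map"


section \<open>The graphs under consideration\<close>

datatype vertex = X nat | Y nat | Z nat

definition G_rd :: "nat \<Rightarrow> nat \<Rightarrow> vertex ugraph" where
  "G_rd r d =
     \<lparr>verts = {X 1, X 2} \<union> Y ` {1..d} \<union> Z ` {1..2 * r - 3},
      edges = {{X 1, Y i} |i. 1 \<le> i \<and> i \<le> d} \<union> {{X 2, Y i} |i. 1 \<le> i \<and> i \<le> d}
            \<union> {{X 1, Z 1}}
            \<union> {{Z (i - 1), Z i} |i. 2 \<le> i \<and> i \<le> 2 * r - 3}
            \<union> {{Z (2 * r - 3), X 2}}\<rparr>"


section \<open>Well-definedness\<close>

lemma finite_simple_graph_G_rd:
  assumes "r \<ge> 3"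
  shows "finite_simple_graph (G_rd r d)"
proof -
  have "Z (i - 1) \<in> Z ` {1..2 * r - 3}" if "2 \<le> i" "i \<le> 2 * r - 3" for i
    using that by (intro imageI) auto
  with assms show ?thesis
    by (auto simp: finite_simple_graph_def G_rd_def card_insert_if)
qed

lemma keys_mult_vars:
  assumes "p \<in> mpolys A" and "q \<in> mpolys A"
  shows "p * q \<in> mpolys A"
proof -
  have "Poly_Mapping.keys m \<subseteq> A" if "m \<in> Poly_Mapping.keys (p * q)" for m
  proof -
    from that obtain a b where "m = a + b" "a \<in> Poly_Mapping.keys p" "b \<in> Poly_Mapping.keys q"
      using keys_mult[of p q] by blast
    with assms show ?thesis
      unfolding mpolys_def using keys_add[of a b] by blast
  qed
  then show ?thesis by (simp add: mpolys_def)
qed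

lemma mpolys_0: "0 \<in> mpolys A"
  by (simp add: mpolys_def)

lemma mpolys_const: "mpoly_const c \<in> mpolys A"
  by (simp add: mpolys_def)

lemma mpolys_1: "(1 :: ('x, 'k::comm_ring_1) mpoly) \<in> mpolys A"
  using mpolys_const[of 1 A] by (simp flip: single_one)

lemma mpolys_add: "p \<in> mpolys A \<Longrightarrow> q \<in> mpolys A \<Longrightarrow> p + q \<in> mpolys A"
  unfolding mpolys_def using keys_add[of p q] by blast

lemma mpolys_uminus: "p \<in> mpolys A \<Longrightarrow> - p \<in> mpolys A"
  for p :: "('x, 'k::comm_ring_1) mpoly"
  by (simp add: mpolys_def)

lemma mpolys_prod: "(\<And>x. x \<in> B \<Longrightarrow> f x \<in> mpolys A) \<Longrightarrow> prod f B \<in> mpolys A"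
  for f :: "'b \<Rightarrow> ('x, 'k::comm_ring_1) mpoly"
  by (induction B rule: infinite_finite_induct) (auto simp: mpolys_1 keys_mult_vars)

lemma mpolys_power: "p \<in> mpolys A \<Longrightarrow> p ^ n \<in> mpolys A"
  for p :: "('x, 'k::comm_ring_1) mpoly"
  by (induction n) (auto simp: mpolys_1 keys_mult_vars)

lemma mpolys_sum: "(\<And>x. x \<in> B \<Longrightarrow> f x \<in> mpolys A) \<Longrightarrow> sum f B \<in> mpolys A"
  for f :: "'b \<Rightarrow> ('x, 'k::comm_ring_1) mpoly"
  by (induction B rule: infinite_finite_induct) (auto simp: mpolys_0 mpolys_add)

lemma cring_mpoly_ring: "cring (mpoly_ring A)"
proof (rule cringI)
  show "abelian_group (mpoly_ring A :: ('a, 'b) mpoly ring)"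
  proof (rule abelian_groupI)
    fix p :: "('a, 'b) mpoly"
    assume "p \<in> carrier (mpoly_ring A)"
    then show "\<exists>q\<in>carrier (mpoly_ring A). q \<oplus>\<^bsub>mpoly_ring A\<^esub> p = \<zero>\<^bsub>mpoly_ring A\<^esub>"
      by (intro bexI[of _ "- p"]) (auto simp: mpoly_ring_def mpolys_uminus)
  qed (auto simp: mpoly_ring_def mpolys_0 mpolys_add algebra_simps)
  show "Group.comm_monoid (mpoly_ring A :: ('a, 'b) mpoly ring)"
    by (rule comm_monoidI) (auto simp: mpoly_ring_def mpolys_1 keys_mult_vars algebra_simps)
qed (auto simp: mpoly_ring_def algebra_simps)

lemma mpoly_subst_superset:
  assumes "finite B" and "Poly_Mapping.keys p \<subseteq> B"
  shows "mpoly_subst f p =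
           (\<Sum>m\<in>B. mpoly_const (Poly_Mapping.lookup p m) *
              (\<Prod>x\<in>Poly_Mapping.keys m. f x ^ Poly_Mapping.lookup m x))"
  unfolding mpoly_subst_def using assms
  by (intro sum.mono_neutral_left) (auto simp: in_keys_iff)

lemma mpoly_subst_add: "mpoly_subst f (p + q) = mpoly_subst f p + mpoly_subst f q"
proof -
  let ?B = "Poly_Mapping.keys p \<union> Poly_Mapping.keys q"
  have "Poly_Mapping.keys (p + q) \<subseteq> ?B" by (rule keys_add)
  then show ?thesis
    by (simp add: mpoly_subst_superset[of ?B] lookup_add single_add distrib_right sum.distrib)
qed

lemma mpoly_subst_0: "mpoly_subst f 0 = 0"
  by (simp add: mpoly_subst_def)

lemma mpoly_subst_sum: "mpoly_subst f (sum g B) = (\<Sum>b\<in>B. mpoly_subst f (g b))"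
  by (induction B rule: infinite_finite_induct) (auto simp: mpoly_subst_0 mpoly_subst_add)

lemma mpoly_subst_single:
  "mpoly_subst f (Poly_Mapping.single m c) =
     mpoly_const c * (\<Prod>x\<in>Poly_Mapping.keys m. f x ^ Poly_Mapping.lookup m x)"
  by (simp add: mpoly_subst_def)

lemma mpoly_subst_var: "mpoly_subst f (mpoly_var x) = f x"
  by (simp add: mpoly_subst_single)

lemma mpoly_subst_const: "mpoly_subst f (mpoly_const c) = mpoly_const c"
  by (simp add: mpoly_subst_single)

lemma prod_power_add:
  fixes f :: "'x \<Rightarrow> ('y, 'k::comm_ring_1) mpoly"
  shows "(\<Prod>x\<in>Poly_Mapping.keys (m + n). f x ^ Poly_Mapping.lookup (m + n) x) =
         (\<Prod>x\<in>Poly_Mapping.keys m. f x ^ Poly_Mapping.lookup m x) *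
         (\<Prod>x\<in>Poly_Mapping.keys n. f x ^ Poly_Mapping.lookup n x)"
proof -
  let ?B = "Poly_Mapping.keys m \<union> Poly_Mapping.keys n"
  have *: "(\<Prod>x\<in>Poly_Mapping.keys l. f x ^ Poly_Mapping.lookup l x) =
           (\<Prod>x\<in>?B. f x ^ Poly_Mapping.lookup l x)"
    if "Poly_Mapping.keys l \<subseteq> ?B" for l
    using that by (intro prod.mono_neutral_left) (auto simp: in_keys_iff)
  show ?thesis
    unfolding *[OF keys_add] *[OF Un_upper1] *[OF Un_upper2]
    by (simp add: lookup_add power_add prod.distrib)
qed

lemma mpoly_sum_monomials: 
  "p = (\<Sum>m\<in>Poly_Mapping.keys p. Poly_Mapping.single m (Poly_Mapping.lookup p m))" (is "p = ?s")
proof (rule poly_mapping_eqI)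
  show "Poly_Mapping.lookup p n = Poly_Mapping.lookup ?s n" for n
    by (cases "n \<in> Poly_Mapping.keys p") (auto simp: lookup_sum lookup_single when_def in_keys_iff)
qed

lemma mpoly_subst_mult: "mpoly_subst f (p * q) = mpoly_subst f p * mpoly_subst f q"
proof -
  have "p * q = (\<Sum>m\<in>Poly_Mapping.keys p. Poly_Mapping.single m (Poly_Mapping.lookup p m)) *
                (\<Sum>n\<in>Poly_Mapping.keys q. Poly_Mapping.single n (Poly_Mapping.lookup q n))"
    by (simp flip: mpoly_sum_monomials)
  then have "mpoly_subst f (p * q) = (\<Sum>m\<in>Poly_Mapping.keys p. \<Sum>n\<in>Poly_Mapping.keys q.
      mpoly_subst f (Poly_Mapping.single (m + n)
        (Poly_Mapping.lookup p m * Poly_Mapping.lookup q n)))"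
    by (simp add: sum_product mult_single mpoly_subst_sum)
  also have "\<dots> = (\<Sum>m\<in>Poly_Mapping.keys p. \<Sum>n\<in>Poly_Mapping.keys q.
      (mpoly_const (Poly_Mapping.lookup p m) *
        (\<Prod>x\<in>Poly_Mapping.keys m. f x ^ Poly_Mapping.lookup m x)) *
      (mpoly_const (Poly_Mapping.lookup q n) *
        (\<Prod>x\<in>Poly_Mapping.keys n. f x ^ Poly_Mapping.lookup n x)))"
    by (intro sum.cong refl)
       (simp add: mpoly_subst_single prod_power_add mult_ac flip: mult_single[of 0 _ 0, simplified])
  also have "\<dots> = mpoly_subst f p * mpoly_subst f q"
    by (simp add: mpoly_subst_def sum_product)
  finally show ?thesis .
qed

lemma ring_hom_cring_toric_map:
  assumes "finite_simple_graph G"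
  shows "ring_hom_cring (mpoly_ring (edges G) :: ('v set, 'k::field) mpoly ring)
           (mpoly_ring (verts G)) toric_map"
proof -
  let ?f = "\<lambda>e. \<Prod>v\<in>e. mpoly_var v :: ('v, 'k) mpoly"
  have *: "?f e \<in> mpolys (verts G)" if "e \<in> edges G" for e
    using that assms by (intro mpolys_prod) (auto simp: finite_simple_graph_def mpolys_def)
  have "mpoly_subst ?f p \<in> mpolys (verts G)" if p: "p \<in> mpolys (edges G)" for p
    unfolding mpoly_subst_def
  proof (intro mpolys_sum keys_mult_vars mpolys_const)
    fix m assume "m \<in> Poly_Mapping.keys p"
    with p have "Poly_Mapping.keys m \<subseteq> edges G"
      by (auto simp: mpolys_def)
    then show "(\<Prod>e\<in>Poly_Mapping.keys m. ?f e ^ Poly_Mapping.lookup m e) \<in> mpolys (verts G)"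
      by (intro mpolys_prod[where A = "verts G"] mpolys_power[where A = "verts G"] *) auto
  qed
  moreover have "mpoly_subst ?f 1 = 1"
    using mpoly_subst_const[of ?f 1] by (simp flip: single_one)
  ultimately have "(toric_map :: ('v set, 'k) mpoly \<Rightarrow> ('v, 'k) mpoly)
      \<in> ring_hom (mpoly_ring (edges G)) (mpoly_ring (verts G))"
    by (intro ring_hom_memI)
       (auto simp: toric_map_def mpoly_ring_def mpoly_subst_add mpoly_subst_mult)
  then show ?thesis
    by (intro ring_hom_cringI cring_mpoly_ring)
qed

lemma ideal_toric_ideal:
  assumes "finite_simple_graph G"
  shows "ideal (toric_ideal G :: ('v set, 'k::field) mpoly set) (mpoly_ring (edges G))"
  unfolding toric_ideal_def
  using ring_hom_cring_toric_map[OF assms] ring_hom_ring.kernel_is_ideal ring_hom_cring.axioms(1,2)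
  by (metis ring_hom_ringI2 cring.axioms(1) ring_hom_cring.homh)

end

theory Submission
  imports Defs "HOL-Library.Countable"
begin

text \<open>
  Let \<open>R = k[E(G)]\<close>. The map \<open>toric_map\<close> sends a monomial in the edges to a monomial in the vertices, so
  \<open>(R/I)\<^sub>i\<close> has as basis the distinct vertex monomials that are products of \<open>i\<close> edges
  (\<open>dim_toric_quotient\<close>). The theorem thus splits into counting these monomials and computing the Krull
  dimension of \<open>R/I\<close>.

  Counting. The vertex monomial of \<open>\<Prod>a\<^sub>i\<^bsup>\<alpha> i\<^esup> b\<^sub>i\<^bsup>\<beta> i\<^esup> \<Prod>e\<^sub>i\<^bsup>e i\<^esup>\<close> depends only on \<open>c = \<alpha> + \<beta>\<close>, on
  \<open>q = \<Sum>\<beta>\<close> and on \<open>e\<close>, where \<open>q \<le> \<Sum>c\<close>; and two triples \<open>(c, q, e)\<close> give the same monomial iff they have the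
  same \<open>c\<close> and differ by a multiple of the move that lowers \<open>q\<close> and all \<open>e\<^sub>1, e\<^sub>3, \<dots>, e\<^sub>2\<^sub>r\<^sub>-\<^sub>3\<close> by one and raises all
  \<open>e\<^sub>2, e\<^sub>4, \<dots>, e\<^sub>2\<^sub>r\<^sub>-\<^sub>2\<close> by one. This move is the binomial of an even cycle through \<open>x\<^sub>1, y\<^sub>i, x\<^sub>2\<close> and all
  the \<open>z\<^sub>j\<close>. Moving as far as possible gives a unique normal form, in which \<open>q = 0\<close> or some
  \<open>e\<^sub>i\<close> with \<open>i\<close> odd vanishes (\<open>rd_degrees_normalize\<close>, \<open>inj_on_normal_forms\<close>). With \<open>E = 1/(1 - t)\<close>, the normal forms
  with \<open>q = 0\<close> contribute \<open>E\<^bsup>d+2r-2\<^esup>\<close>. In the others, \<open>(c, q)\<close> with \<open>1 \<le> q \<le> \<Sum>c\<close> contributes \<open>t (E\<^sup>d)'\<close>, and \<open>e\<close>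
  contributes \<open>(1 - t\<^bsup>r-1\<^esup>) E\<^bsup>2r-2\<^esup>\<close>. The sum is the claimed series (\<open>weight_series_normal_forms\<close>).

  Krull dimension, upper bound. If \<open>P\<^sub>0 \<subset> \<dots> \<subset> P\<^sub>n\<close> are primes containing \<open>I\<close> and \<open>p\<^sub>i \<in> P\<^sub>i\<^sub>+\<^sub>1 - P\<^sub>i\<close>, then the monomials
  in \<open>p\<^sub>0, \<dots>, p\<^sub>n\<^sub>-\<^sub>1\<close> are linearly independent modulo \<open>P\<^sub>0\<close> (\<open>prime_chain_independent\<close>). There are \<open>(s + 1)\<^sup>n\<close> of them
  with exponents at most \<open>s\<close>, while their images lie in a space of dimension \<open>O(s\<^sup>D)\<close>, \<open>D = d + 2r - 2\<close>: the graph is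
  bipartite on \<open>D + 1\<close> vertices, so a product of edges is determined by \<open>D\<close> of its exponents
  (\<open>edge_degrees_growth_bipartite\<close>). Hence \<open>n \<le> D\<close>.

  Krull dimension, lower bound. A face is a set \<open>F\<close> of edges such that whether an edge monomial is supported in \<open>F\<close> can be
  read off from its vertex monomial. Setting the edges outside a face to zero maps \<open>R/I\<close> to a domain, so faces give primes
  containing \<open>I\<close>, and larger faces give smaller primes. Removing \<open>y\<^sub>1, \<dots>, y\<^sub>d\<^sub>-\<^sub>1\<close> one at a time leaves a cycle of
  length \<open>2r\<close>; then removing \<open>e\<^sub>1\<close> and \<open>e\<^sub>2\<close> together leaves a path, and its \<open>2r - 2\<close> edges can be removed one at a
  time. This is a chain of \<open>d - 1 + 1 + (2r - 2) = D\<close> strict inclusions (\<open>face_chain\<close>).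
\<close>

section \<open>The toric map on monomials\<close>

text \<open>
  The exponent vector of the image under the toric map of the edge monomial with exponents \<open>m\<close>.
\<close>

definition vdeg :: "('v set \<Rightarrow>\<^sub>0 nat) \<Rightarrow> ('v \<Rightarrow>\<^sub>0 nat)" where
  "vdeg m = (\<Sum>e\<in>Poly_Mapping.keys m. \<Sum>v\<in>e. Poly_Mapping.single v (Poly_Mapping.lookup m e))"

text \<open>
  Equivalently: the exponent vectors of all products of \<open>i\<close> edges.
\<close>

definition edge_degrees :: "'v ugraph \<Rightarrow> nat \<Rightarrow> ('v \<Rightarrow>\<^sub>0 nat) set" where
  "edge_degrees G i = vdeg ` {m. Poly_Mapping.keys m \<subseteq> edges G \<and> monom_degree m = i}"

text \<open>
  The toric map after setting the edges outside \<open>F\<close> to zero. The case \<open>F = UNIV\<close> is the toric map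
  itself, so that both can be treated together.
\<close>

definition face_map :: "'v set set \<Rightarrow> ('v set, 'k::field) mpoly \<Rightarrow> ('v, 'k) mpoly" where
  "face_map F = mpoly_subst (\<lambda>e. if e \<in> F then \<Prod>v\<in>e. mpoly_var v else 0)"

lemma toric_map_eq_face_map: "toric_map = face_map UNIV"
  by (simp add: toric_map_def face_map_def)

lemma prod_single_one:
  "(\<Prod>x\<in>B. Poly_Mapping.single (f x) (1::'k::comm_ring_1)) =
     Poly_Mapping.single (\<Sum>x\<in>B. f x :: 'a::comm_monoid_add) 1"
  by (induction B rule: infinite_finite_induct) (simp_all add: mult_single)

lemma mpoly_var_power:
  "(mpoly_var x :: ('x, 'k::comm_ring_1) mpoly) ^ n = Poly_Mapping.single (Poly_Mapping.single x n) 1"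
  by (induction n) (simp_all add: mult_single single_add[symmetric])

lemma lookup_vdeg:
  assumes "finite E" "Poly_Mapping.keys m \<subseteq> E" "\<And>e. e \<in> E \<Longrightarrow> finite e"
  shows "Poly_Mapping.lookup (vdeg m) v = (\<Sum>e\<in>E. if v \<in> e then Poly_Mapping.lookup m e else 0)"
proof -
  have "Poly_Mapping.lookup (vdeg m) v =
      (\<Sum>e\<in>Poly_Mapping.keys m. if v \<in> e then Poly_Mapping.lookup m e else 0)"
    using assms unfolding vdeg_def lookup_sum lookup_single when_def
    by (intro sum.cong refl) (auto simp: sum.delta)
  also have "\<dots> = (\<Sum>e\<in>E. if v \<in> e then Poly_Mapping.lookup m e else 0)"
    using assms by (intro sum.mono_neutral_left) (auto simp: in_keys_iff)
  finally show ?thesis .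
qed

lemma face_map_single:
  "face_map F (Poly_Mapping.single m c) =
     (if Poly_Mapping.keys m \<subseteq> F then Poly_Mapping.single (vdeg m) c else 0)"
proof (cases "Poly_Mapping.keys m \<subseteq> F")
  case True
  then have "(\<Prod>e\<in>Poly_Mapping.keys m.
        (if e \<in> F then \<Prod>v\<in>e. mpoly_var v else 0) ^ Poly_Mapping.lookup m e) =
      (\<Prod>e\<in>Poly_Mapping.keys m. \<Prod>v\<in>e. mpoly_var v ^ Poly_Mapping.lookup m e :: ('a, 'b) mpoly)"
    by (intro prod.cong refl) (auto simp: prod_power_distrib)
  also have "\<dots> = Poly_Mapping.single (vdeg m) 1"
    by (simp add: mpoly_var_power[unfolded One_nat_def] prod_single_one vdeg_def)
  finally show ?thesis
    using True by (simp add: face_map_def mpoly_subst_single mult_single)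
next
  case False
  then obtain e where "e \<in> Poly_Mapping.keys m" "e \<notin> F" by auto
  then have "(\<Prod>e\<in>Poly_Mapping.keys m.
        (if e \<in> F then \<Prod>v\<in>e. mpoly_var v else 0 :: ('a, 'b) mpoly) ^ Poly_Mapping.lookup m e) = 0"
    by (intro prod_zero) (auto intro!: bexI[of _ e] simp: in_keys_iff zero_power)
  then show ?thesis
    using False by (simp only: face_map_def mpoly_subst_single) simp
qed

text \<open>
  A coefficient of the image collects the coefficients of all edge monomials over one vertex monomial. So the kernel is
  described fibre by fibre over the vertex monomials.
\<close>

lemma lookup_face_map:
  "Poly_Mapping.lookup (face_map F p) h =
     (\<Sum>m\<in>{m \<in> Poly_Mapping.keys p. Poly_Mapping.keys m \<subseteq> F \<and> vdeg m = h}. Poly_Mapping.lookup p m)"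
proof -
  have "face_map F p =
      (\<Sum>m\<in>Poly_Mapping.keys p. face_map F (Poly_Mapping.single m (Poly_Mapping.lookup p m)))"
    by (subst mpoly_sum_monomials[of p]) (simp only: face_map_def mpoly_subst_sum)
  then have "Poly_Mapping.lookup (face_map F p) h =
      (\<Sum>m\<in>Poly_Mapping.keys p. if Poly_Mapping.keys m \<subseteq> F \<and> vdeg m = h then Poly_Mapping.lookup p m else 0)"
    by (auto simp: face_map_single lookup_sum lookup_single when_def intro!: sum.cong)
  then show ?thesis by (simp add: sum.inter_filter)
qed

lemma face_map_add: "face_map F (p + q) = face_map F p + face_map F q"
  by (simp add: face_map_def mpoly_subst_add)

lemma face_map_mult: "face_map F (p * q) = face_map F p * face_map F q"
  by (simp add: face_map_def mpoly_subst_mult)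

lemma face_map_const: "face_map F (mpoly_const c) = mpoly_const c"
  by (simp add: face_map_def mpoly_subst_const)

lemma face_map_0: "face_map F 0 = 0"
  by (simp add: face_map_def mpoly_subst_0)

lemma face_map_diff: "face_map F (p - q) = face_map F p - face_map F q"
  using face_map_add[of F "p - q" q] by simp

lemma toric_map_single: "toric_map (Poly_Mapping.single m c) = Poly_Mapping.single (vdeg m) c"
  by (simp add: toric_map_eq_face_map face_map_single)

lemmas toric_map_add = face_map_add[of UNIV, folded toric_map_eq_face_map]
lemmas toric_map_diff = face_map_diff[of UNIV, folded toric_map_eq_face_map]
lemmas toric_map_const = face_map_const[of UNIV, folded toric_map_eq_face_map]
lemmas toric_map_0 = face_map_0[of UNIV, folded toric_map_eq_face_map]

lemma keys_toric_map: "Poly_Mapping.keys (toric_map p) \<subseteq> vdeg ` Poly_Mapping.keys p"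
proof
  fix h assume "h \<in> Poly_Mapping.keys (toric_map p)"
  then have "(\<Sum>m\<in>{m \<in> Poly_Mapping.keys p. vdeg m = h}. Poly_Mapping.lookup p m) \<noteq> 0"
    by (simp add: in_keys_iff toric_map_eq_face_map lookup_face_map)
  then have "{m \<in> Poly_Mapping.keys p. vdeg m = h} \<noteq> {}"
    by (metis (no_types, lifting) sum.empty)
  then show "h \<in> vdeg ` Poly_Mapping.keys p" by blast
qed

lemma mem_toric_ideal_iff:
  "p \<in> toric_ideal G \<longleftrightarrow> p \<in> mpolys (edges G) \<and> toric_map p = 0"
  by (auto simp: toric_ideal_def a_kernel_def' mpoly_ring_def)

lemma mpolys_diff: "p \<in> mpolys A \<Longrightarrow> q \<in> mpolys A \<Longrightarrow> p - q \<in> mpolys A"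
  for p :: "('x, 'k::comm_ring_1) mpoly"
  using mpolys_add[of p A "- q"] mpolys_uminus[of q A] by simp

lemma finite_bounded_monomials:
  assumes "finite A"
  shows "finite {m :: 'x \<Rightarrow>\<^sub>0 nat. Poly_Mapping.keys m \<subseteq> A \<and> (\<forall>x. Poly_Mapping.lookup m x \<le> N)}"
proof -
  have "inj_on (\<lambda>m. restrict (Poly_Mapping.lookup m) A)
      {m :: 'x \<Rightarrow>\<^sub>0 nat. Poly_Mapping.keys m \<subseteq> A \<and> (\<forall>x. Poly_Mapping.lookup m x \<le> N)}"
  proof (rule inj_onI, rule poly_mapping_eqI)
    fix m n :: "'x \<Rightarrow>\<^sub>0 nat" and x
    assume *: "m \<in> {m. Poly_Mapping.keys m \<subseteq> A \<and> (\<forall>x. Poly_Mapping.lookup m x \<le> N)}"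
      "n \<in> {m. Poly_Mapping.keys m \<subseteq> A \<and> (\<forall>x. Poly_Mapping.lookup m x \<le> N)}"
      "restrict (Poly_Mapping.lookup m) A = restrict (Poly_Mapping.lookup n) A"
    show "Poly_Mapping.lookup m x = Poly_Mapping.lookup n x"
    proof (cases "x \<in> A")
      case True
      then show ?thesis using fun_cong[OF *(3), of x] by simp
    next
      case False
      then have "x \<notin> Poly_Mapping.keys m" "x \<notin> Poly_Mapping.keys n" using * by auto
      then show ?thesis by (simp add: in_keys_iff)
    qed
  qed
  moreover have "(\<lambda>m. restrict (Poly_Mapping.lookup m) A) `
      {m :: 'x \<Rightarrow>\<^sub>0 nat. Poly_Mapping.keys m \<subseteq> A \<and> (\<forall>x. Poly_Mapping.lookup m x \<le> N)} \<subseteq> PiE A (\<lambda>_. {..N})"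
    by auto
  ultimately show ?thesis
    using assms by (meson finite_PiE finite_atMost inj_on_finite)
qed

lemma lookup_le_monom_degree: "Poly_Mapping.lookup m x \<le> monom_degree m"
proof (cases "x \<in> Poly_Mapping.keys m")
  case True
  then show ?thesis unfolding monom_degree_def by (intro member_le_sum) auto
qed (simp add: in_keys_iff)

lemma finite_simple_graph_edges:
  assumes "finite_simple_graph G"
  shows "finite (edges G)" "\<And>e. e \<in> edges G \<Longrightarrow> finite e"
proof -
  have "edges G \<subseteq> Pow (verts G)" using assms by (auto simp: finite_simple_graph_def)
  then show "finite (edges G)" using assms finite_subset by (auto simp: finite_simple_graph_def)
  show "finite e" if "e \<in> edges G" for e
    using that assms by (auto simp: finite_simple_graph_def intro: card_ge_0_finite)
qed

lemma finite_edge_degrees: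
  assumes "finite_simple_graph G"
  shows "finite (edge_degrees G i)"
proof -
  have "{m. Poly_Mapping.keys m \<subseteq> edges G \<and> monom_degree m = i} \<subseteq>
      {m. Poly_Mapping.keys m \<subseteq> edges G \<and> (\<forall>x. Poly_Mapping.lookup m x \<le> i)}"
    by (auto intro: lookup_le_monom_degree)
  then show ?thesis
    unfolding edge_degrees_def
    using finite_bounded_monomials[OF finite_simple_graph_edges(1)[OF assms]] finite_subset by blast
qed

section \<open>The Hilbert function of a toric quotient\<close>

lemma mpoly_ring_simps:
  "carrier (mpoly_ring A) = mpolys A" "p \<otimes>\<^bsub>mpoly_ring A\<^esub> q = p * q" "p \<oplus>\<^bsub>mpoly_ring A\<^esub> q = p + q"
  "\<one>\<^bsub>mpoly_ring A\<^esub> = 1" "\<zero>\<^bsub>mpoly_ring A\<^esub> = 0"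
  by (simp_all add: mpoly_ring_def)

lemma rcoset_eq_iff:
  fixes I :: "('x, 'k::comm_ring_1) mpoly set"
  assumes "ideal I (mpoly_ring A)" "p \<in> mpolys A" "q \<in> mpolys A"
  shows "I +>\<^bsub>mpoly_ring A\<^esub> p = I +>\<^bsub>mpoly_ring A\<^esub> q \<longleftrightarrow> p - q \<in> I"
proof -
  interpret ideal I "mpoly_ring A" by fact
  have minus: "\<ominus>\<^bsub>mpoly_ring A\<^esub> q = - q"
    by (rule minus_equality) (use assms in \<open>auto simp: mpoly_ring_simps mpolys_uminus\<close>)
  show ?thesis
    using quotient_eq_iff_same_a_r_cos[OF assms(1), of p q] assms
    by (auto simp: a_minus_def minus mpoly_ring_simps)
qed

lemma subfield_quot_const:
  fixes I :: "('x, 'k::field) mpoly set"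
  assumes "ideal I (mpoly_ring A)" "1 \<notin> I"
  shows "subfield (quot_const A I) (mpoly_ring A Quot I)"
proof -
  interpret R: cring "mpoly_ring A :: ('x, 'k) mpoly ring" by (rule cring_mpoly_ring)
  interpret ideal I "mpoly_ring A" by fact
  interpret Q: ring_hom_ring "mpoly_ring A" "mpoly_ring A Quot I" "(+>\<^bsub>mpoly_ring A\<^esub>) I"
    by (rule rcos_ring_hom_ring)
  let ?K = "range mpoly_const :: ('x, 'k) mpoly set"
  have minus: "\<ominus>\<^bsub>mpoly_ring A\<^esub> (mpoly_const c :: ('x, 'k) mpoly) = mpoly_const (- c)" for c
    by (rule R.minus_equality) (auto simp: mpoly_ring_simps mpolys_const single_add[symmetric])
  have sub: "subcring ?K (mpoly_ring A)"
  proof (rule R.subcringI', rule R.subringI)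
    show "?K \<subseteq> carrier (mpoly_ring A)" by (auto simp: mpoly_ring_simps mpolys_const)
    show "\<one>\<^bsub>mpoly_ring A\<^esub> \<in> ?K" by (auto simp: mpoly_ring_simps simp flip: single_one)
  qed (auto simp: mpoly_ring_simps minus mult_single single_add[symmetric])
  have "subfield ?K (mpoly_ring A)"
  proof (rule R.subfieldI[OF sub], rule equalityI)
    show "Units (mpoly_ring A\<lparr>carrier := ?K\<rparr>) \<subseteq> ?K - {\<zero>\<^bsub>mpoly_ring A\<^esub>}"
      by (auto simp: Units_def mpoly_ring_simps)
    show "?K - {\<zero>\<^bsub>mpoly_ring A\<^esub>} \<subseteq> Units (mpoly_ring A\<lparr>carrier := ?K\<rparr>)"
    proof
      fix p assume "p \<in> ?K - {\<zero>\<^bsub>mpoly_ring A\<^esub>}"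
      then obtain c where "p = mpoly_const c" "p \<noteq> 0" by (auto simp: mpoly_ring_simps)
      then have "p = mpoly_const c" "c \<noteq> 0" by auto
      then have "mpoly_const (inverse c) * p = 1" "p * mpoly_const (inverse c) = 1"
        by (simp_all add: mult_single)
      then show "p \<in> Units (mpoly_ring A\<lparr>carrier := ?K\<rparr>)"
        using \<open>p = mpoly_const c\<close> unfolding Units_def by (simp add: mpoly_ring_simps) blast
    qed
  qed
  moreover have "\<one>\<^bsub>mpoly_ring A Quot I\<^esub> \<noteq> \<zero>\<^bsub>mpoly_ring A Quot I\<^esub>"
  proof
    assume "\<one>\<^bsub>mpoly_ring A Quot I\<^esub> = \<zero>\<^bsub>mpoly_ring A Quot I\<^esub>"
    then have "I +>\<^bsub>mpoly_ring A\<^esub> 1 = I +>\<^bsub>mpoly_ring A\<^esub> 0"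
      using R.a_coset_add_zero[OF a_subset] by (simp add: FactRing_def mpoly_ring_simps)
    then show False
      using assms rcoset_eq_iff[OF assms(1) mpolys_1 mpolys_0] by simp
  qed
  ultimately show ?thesis
    unfolding quot_const_def using Q.img_is_subfield(2)[of ?K] by (simp add: image_image)
qed

lemma one_notin_toric_ideal: "1 \<notin> toric_ideal G"
proof -
  have "toric_map (1 :: ('a set, 'b) mpoly) = 1"
    using toric_map_const[of "1 :: 'b"] by simp
  then show ?thesis by (simp add: mem_toric_ideal_iff)
qed

text \<open>
  The toric map identifies \<open>(R/I)\<^sub>i\<close> with the span of the vertex monomials in \<open>edge_degrees G i\<close>. The space of classes whose
  image involves only a given set \<open>B\<close> of these monomials grows by exactly one dimension when a monomial is added to \<open>B\<close>: the
  new direction is the class of any edge monomial over it.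
\<close>

lemma dim_toric_quotient:
  assumes G: "finite_simple_graph G"
  defines "I \<equiv> toric_ideal G :: ('v set, 'k::field) mpoly set"
  shows "ring.dim (mpoly_ring (edges G) Quot I) (quot_const (edges G) I) (quot_component (edges G) I i)
       = card (edge_degrees G i)"
proof -
  let ?R = "mpoly_ring (edges G) :: ('v set, 'k) mpoly ring"
  let ?S = "?R Quot I" and ?K = "quot_const (edges G) I"
  let ?cos = "\<lambda>p. I +>\<^bsub>?R\<^esub> p"
  have ideal: "ideal I ?R" unfolding I_def by (rule ideal_toric_ideal[OF G])
  interpret ideal I ?R by (rule ideal)
  interpret Q: ring_hom_ring ?R ?S "?cos" by (rule rcos_ring_hom_ring)
  have K: "subfield ?K ?S"
    by (rule subfield_quot_const[OF ideal]) (simp add: I_def one_notin_toric_ideal)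
  have cos_eq: "?cos p = ?cos q \<longleftrightarrow> toric_map p = toric_map q"
    if "p \<in> mpolys (edges G)" "q \<in> mpolys (edges G)" for p q
    using that rcoset_eq_iff[OF ideal that]
    by (simp add: I_def mem_toric_ideal_iff mpolys_diff toric_map_diff)
  have cos_add: "?cos (p + q) = ?cos p \<oplus>\<^bsub>?S\<^esub> ?cos q"
    and cos_mult: "?cos (p * q) = ?cos p \<otimes>\<^bsub>?S\<^esub> ?cos q"
    if "p \<in> mpolys (edges G)" "q \<in> mpolys (edges G)" for p q
    using that Q.hom_add[of p q] Q.hom_mult[of p q] by (simp_all add: mpoly_ring_simps)
  \<comment> \<open>The classes of forms whose image involves only the vertex monomials in \<open>B\<close>.\<close>
  define E where "E B = ?cos ` {p \<in> mpoly_forms (edges G) i. Poly_Mapping.keys (toric_map p) \<subseteq> B}" for B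
  have forms: "p \<in> mpolys (edges G)" if "p \<in> mpoly_forms (edges G) i" for p :: "('v set, 'k) mpoly"
    using that by (simp add: mpoly_forms_def)
  have dim: "Q.S.dimension (card B) ?K (E B)" if "finite B" "B \<subseteq> edge_degrees G i" for B
    using that
  proof (induction B rule: finite_induct)
    case empty
    have "E {} = {?cos 0}"
    proof
      show "E {} \<subseteq> {?cos 0}"
        using cos_eq[OF forms mpolys_0] by (auto simp: E_def toric_map_0)
      show "{?cos 0} \<subseteq> E {}"
        by (auto simp: E_def toric_map_0 mpoly_forms_def mpolys_0 intro!: imageI)
    qed
    also have "?cos 0 = \<zero>\<^bsub>?S\<^esub>"
      using Q.hom_zero by (simp add: mpoly_ring_simps)
    finally show ?case using Q.S.dimension.zero_dim by simp
  next
    case (insert h B)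
    then obtain m where m: "Poly_Mapping.keys m \<subseteq> edges G" "monom_degree m = i" "h = vdeg m"
      by (auto simp: edge_degrees_def)
    let ?x = "Poly_Mapping.single m 1 :: ('v set, 'k) mpoly"
    have x: "?x \<in> mpoly_forms (edges G) i"
      using m by (simp add: mpoly_forms_def mpolys_def)
    have tx: "toric_map ?x = Poly_Mapping.single h 1" by (simp add: toric_map_single m)
    have "?cos ?x \<notin> E B"
    proof
      assume "?cos ?x \<in> E B"
      then obtain p where p: "p \<in> mpoly_forms (edges G) i" "Poly_Mapping.keys (toric_map p) \<subseteq> B"
        "?cos ?x = ?cos p" by (auto simp: E_def)
      then have "toric_map p = Poly_Mapping.single h 1"
        using cos_eq[OF forms[OF x] forms[OF p(1)]] tx by simp
      then show False using p(2) insert.hyps by simp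
    qed
    moreover have "?cos ?x \<in> carrier ?S"
      using Q.hom_closed forms[OF x] by (simp add: mpoly_ring_simps)
    ultimately have "Q.S.dimension (Suc (card B)) ?K (Q.S.line_extension ?K (?cos ?x) (E B))"
      using insert by (intro Q.S.dimension.Suc_dim) auto
    moreover have "Q.S.line_extension ?K (?cos ?x) (E B) = E (insert h B)"
    proof (intro equalityI subsetI)
      fix u assume "u \<in> Q.S.line_extension ?K (?cos ?x) (E B)"
      then obtain c p where p: "p \<in> mpoly_forms (edges G) i" "Poly_Mapping.keys (toric_map p) \<subseteq> B"
        and u: "u = ?cos (mpoly_const c) \<otimes>\<^bsub>?S\<^esub> ?cos ?x \<oplus>\<^bsub>?S\<^esub> ?cos p"
        unfolding Q.S.line_extension_mem_iff by (auto simp: E_def quot_const_def)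
      let ?q = "mpoly_const c * ?x + p"
      have "u = ?cos ?q"
        unfolding u cos_add[OF keys_mult_vars[OF mpolys_const forms[OF x]] forms[OF p(1)]]
          cos_mult[OF mpolys_const forms[OF x]] ..
      moreover have "Poly_Mapping.keys (toric_map ?q) \<subseteq> insert h B"
        using p(2) Poly_Mapping.keys_add[of "Poly_Mapping.single h c" "toric_map p"]
        by (auto simp: toric_map_add mult_single toric_map_single m split: if_splits)
      moreover have "?q \<in> mpoly_forms (edges G) i"
        using p(1) m Poly_Mapping.keys_add[of "Poly_Mapping.single m c" p]
        by (auto simp: mpoly_forms_def mult_single mpolys_def split: if_splits)
      ultimately show "u \<in> E (insert h B)" by (auto simp: E_def)
    next
      fix u assume "u \<in> E (insert h B)"
      then obtain p where p: "p \<in> mpoly_forms (edges G) i" "Poly_Mapping.keys (toric_map p) \<subseteq> insert h B"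
        and u: "u = ?cos p" by (auto simp: E_def)
      define c where "c = Poly_Mapping.lookup (toric_map p) h"
      let ?q = "p - Poly_Mapping.single m c"
      have q: "?q \<in> mpoly_forms (edges G) i"
        using p(1) m Poly_Mapping.keys_diff[of p "Poly_Mapping.single m c"]
        by (auto simp: mpoly_forms_def mpolys_def split: if_splits)
      have "Poly_Mapping.keys (toric_map ?q) \<subseteq> B"
        using p(2) by (auto simp: toric_map_diff toric_map_single m(3)[symmetric] in_keys_iff lookup_minus
            lookup_single c_def when_def subset_iff split: if_splits)
      then have "?cos ?q \<in> E B" using q by (auto simp: E_def)
      moreover have "u = ?cos (mpoly_const c * ?x + ?q)"
        by (simp add: u mult_single)
      then have "u = ?cos (mpoly_const c) \<otimes>\<^bsub>?S\<^esub> ?cos ?x \<oplus>\<^bsub>?S\<^esub> ?cos ?q"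
        unfolding cos_add[OF keys_mult_vars[OF mpolys_const forms[OF x]] forms[OF q]]
          cos_mult[OF mpolys_const forms[OF x]] .
      ultimately show "u \<in> Q.S.line_extension ?K (?cos ?x) (E B)"
        unfolding Q.S.line_extension_mem_iff quot_const_def by blast
    qed
    ultimately show ?case using insert.hyps by simp
  qed
  have "Poly_Mapping.keys (toric_map p) \<subseteq> edge_degrees G i"
    if "p \<in> mpoly_forms (edges G) i" for p :: "('v set, 'k) mpoly"
    using that keys_toric_map[of p]
    by (fastforce simp: edge_degrees_def mpoly_forms_def mpolys_def)
  then have "E (edge_degrees G i) = quot_component (edges G) I i"
    unfolding E_def quot_component_def by blast
  then show ?thesis
    using Q.S.dimI[OF K dim[OF finite_edge_degrees[OF G] order_refl]] by (simp add: over_def)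
qed

section \<open>Chains of primes\<close>

lemma primeideal_quot_image:
  assumes R: "cring R" and I: "ideal I R" and J: "primeideal J R" and IJ: "I \<subseteq> J"
  shows "primeideal ((\<lambda>r. I +>\<^bsub>R\<^esub> r) ` J) (R Quot I)"
    and "{r \<in> carrier R. I +>\<^bsub>R\<^esub> r \<in> (\<lambda>r. I +>\<^bsub>R\<^esub> r) ` J} = J"
proof -
  interpret cring R by fact
  interpret I: ideal I R by fact
  interpret J: primeideal J R by fact
  interpret Q: ring_hom_ring R "R Quot I" "(+>\<^bsub>R\<^esub>) I" by (rule I.rcos_ring_hom_ring)
  have carr: "carrier (R Quot I) = (\<lambda>r. I +>\<^bsub>R\<^esub> r) ` carrier R"
    unfolding FactRing_def A_RCOSETS_def' by auto
  show pre: "{r \<in> carrier R. I +>\<^bsub>R\<^esub> r \<in> (\<lambda>r. I +>\<^bsub>R\<^esub> r) ` J} = J"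
  proof
    show "{r \<in> carrier R. I +>\<^bsub>R\<^esub> r \<in> (\<lambda>r. I +>\<^bsub>R\<^esub> r) ` J} \<subseteq> J"
    proof safe
      fix r j assume r: "r \<in> carrier R" and j: "j \<in> J" and "I +>\<^bsub>R\<^esub> r = I +>\<^bsub>R\<^esub> j"
      then have "r \<ominus>\<^bsub>R\<^esub> j \<in> J"
        using quotient_eq_iff_same_a_r_cos[OF I r J.Icarr[OF j]] IJ by auto
      then have "(r \<ominus>\<^bsub>R\<^esub> j) \<oplus>\<^bsub>R\<^esub> j \<in> J" using j by (rule J.a_closed)
      then show "r \<in> J" using r J.Icarr[OF j] by (simp add: a_minus_def a_assoc l_neg)
    qed
  qed (use J.Icarr in auto)
  show "primeideal ((\<lambda>r. I +>\<^bsub>R\<^esub> r) ` J) (R Quot I)"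
  proof (rule primeidealI)
    show "ideal ((\<lambda>r. I +>\<^bsub>R\<^esub> r) ` J) (R Quot I)"
      by (rule ring_ideal_imp_quot_ideal[OF I J.is_ideal])
    show "cring (R Quot I)" by (rule I.quotient_is_cring[OF R])
    show "carrier (R Quot I) \<noteq> (\<lambda>r. I +>\<^bsub>R\<^esub> r) ` J"
    proof
      assume "carrier (R Quot I) = (\<lambda>r. I +>\<^bsub>R\<^esub> r) ` J"
      then have "carrier R \<subseteq> J" using pre Q.hom_closed by auto
      then show False using J.I_notcarr J.a_subset by auto
    qed
    fix a b assume "a \<in> carrier (R Quot I)" "b \<in> carrier (R Quot I)"
      and ab: "a \<otimes>\<^bsub>R Quot I\<^esub> b \<in> (\<lambda>r. I +>\<^bsub>R\<^esub> r) ` J"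
    then obtain x y where xy: "x \<in> carrier R" "y \<in> carrier R" "a = I +>\<^bsub>R\<^esub> x" "b = I +>\<^bsub>R\<^esub> y"
      unfolding carr by blast
    then have "I +>\<^bsub>R\<^esub> (x \<otimes>\<^bsub>R\<^esub> y) \<in> (\<lambda>r. I +>\<^bsub>R\<^esub> r) ` J"
      using ab by simp
    then have "x \<otimes>\<^bsub>R\<^esub> y \<in> J" using pre xy by blast
    then show "a \<in> (\<lambda>r. I +>\<^bsub>R\<^esub> r) ` J \<or> b \<in> (\<lambda>r. I +>\<^bsub>R\<^esub> r) ` J"
      using J.I_prime xy by blast
  qed
qed

text \<open>
  Primes of \<open>R/I\<close> correspond, strictly monotonically, to primes of \<open>R\<close> that contain \<open>I\<close>. This allows working with
  polynomials in place of cosets.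
\<close>

lemma krull_dim_quot:
  assumes R: "cring R" and I: "ideal I R"
  shows "krull_dim (R Quot I) =
    Sup {enat n |n. \<exists>P. (\<forall>i\<le>n. primeideal (P i) R \<and> I \<subseteq> P i) \<and> (\<forall>i<n. P i \<subset> P (Suc i))}"
proof -
  interpret cring R by fact
  interpret I: ideal I R by fact
  interpret Q: ring_hom_ring R "R Quot I" "(+>\<^bsub>R\<^esub>) I" by (rule I.rcos_ring_hom_ring)
  let ?pre = "\<lambda>J. {r \<in> carrier R. I +>\<^bsub>R\<^esub> r \<in> J}" and ?img = "\<lambda>J. (\<lambda>r. I +>\<^bsub>R\<^esub> r) ` J"
  have "(\<exists>P. (\<forall>i\<le>n. primeideal (P i) (R Quot I)) \<and> (\<forall>i<n. P i \<subset> P (Suc i))) \<longleftrightarrow>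
      (\<exists>P. (\<forall>i\<le>n. primeideal (P i) R \<and> I \<subseteq> P i) \<and> (\<forall>i<n. P i \<subset> P (Suc i)))" for n
  proof safe
    fix P assume P: "\<forall>i\<le>n. primeideal (P i) (R Quot I)" "\<forall>i<n. P i \<subset> P (Suc i)"
    have "primeideal (?pre (P i)) R" "I \<subseteq> ?pre (P i)" "?img (?pre (P i)) = P i" if "i \<le> n" for i
    proof -
      interpret Pi: primeideal "P i" "R Quot I" using P that by blast
      show "primeideal (?pre (P i)) R"
        by (rule Q.primeideal_vimage[OF R Pi.primeideal_axioms])
      show "I \<subseteq> ?pre (P i)"
      proof
        fix x assume x: "x \<in> I"
        then have "I +>\<^bsub>R\<^esub> x = I" by (rule I.a_rcos_const)
        then show "x \<in> ?pre (P i)"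
          using I.Icarr[OF x] additive_subgroup.zero_closed[OF Pi.is_additive_subgroup]
          unfolding FactRing_def by auto
      qed
      have "P i \<subseteq> carrier (R Quot I)" by (rule Pi.a_subset)
      then have "P i \<subseteq> ?img (carrier R)" unfolding FactRing_def A_RCOSETS_def' by auto
      then show "?img (?pre (P i)) = P i" by blast
    qed note pre = this
    show "\<exists>P. (\<forall>i\<le>n. primeideal (P i) R \<and> I \<subseteq> P i) \<and> (\<forall>i<n. P i \<subset> P (Suc i))"
    proof (intro exI[of _ "\<lambda>i. ?pre (P i)"] conjI allI impI)
      fix i assume i: "i < n"
      then have "i \<le> n" "Suc i \<le> n" by auto
      then have "?img (?pre (P i)) \<noteq> ?img (?pre (P (Suc i)))"
        unfolding pre(3)[OF \<open>i \<le> n\<close>] pre(3)[OF \<open>Suc i \<le> n\<close>] using P(2) i by blast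
      then have "?pre (P i) \<noteq> ?pre (P (Suc i))" by metis
      moreover have "?pre (P i) \<subseteq> ?pre (P (Suc i))" using P(2) i by blast
      ultimately show "?pre (P i) \<subset> ?pre (P (Suc i))" by (rule psubsetI[rotated])
    qed (use pre(1,2) in auto)
  next
    fix P assume P: "\<forall>i\<le>n. primeideal (P i) R \<and> I \<subseteq> P i" "\<forall>i<n. P i \<subset> P (Suc i)"
    show "\<exists>P. (\<forall>i\<le>n. primeideal (P i) (R Quot I)) \<and> (\<forall>i<n. P i \<subset> P (Suc i))"
    proof (intro exI[of _ "\<lambda>i. ?img (P i)"] conjI allI impI)
      fix i assume "i \<le> n"
      then show "primeideal (?img (P i)) (R Quot I)"
        using P primeideal_quot_image(1)[OF R I] by blast
    next
      fix i assume i: "i < n"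
      have "?pre (?img (P k)) = P k" if "k \<le> n" for k
        using P(1) that by (intro primeideal_quot_image(2)[OF R I]) blast+
      then have "?pre (?img (P i)) = P i" "?pre (?img (P (Suc i))) = P (Suc i)"
        using i by (meson Suc_leI less_imp_le)+
      then have "?img (P i) \<noteq> ?img (P (Suc i))" using P(2) i by (metis psubset_eq)
      moreover have "?img (P i) \<subseteq> ?img (P (Suc i))" using P(2) i by (intro image_mono) blast
      ultimately show "?img (P i) \<subset> ?img (P (Suc i))" by (rule psubsetI[rotated])
    qed
  qed
  then show ?thesis by (simp add: krull_dim_def)
qed

lemma mpoly_primeidealD:
  fixes P :: "('x, 'k::field) mpoly set"
  assumes "primeideal P (mpoly_ring A)"
  shows "P \<subseteq> mpolys A" "0 \<in> P"
    "\<And>p q. p \<in> P \<Longrightarrow> q \<in> P \<Longrightarrow> p + q \<in> P"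
    "\<And>p q. p \<in> P \<Longrightarrow> q \<in> mpolys A \<Longrightarrow> q * p \<in> P"
    "\<And>p q. p \<in> mpolys A \<Longrightarrow> q \<in> mpolys A \<Longrightarrow> p * q \<in> P \<Longrightarrow> p \<in> P \<or> q \<in> P"
    "\<And>c. c \<noteq> 0 \<Longrightarrow> mpoly_const c \<notin> P"
proof -
  interpret P: primeideal P "mpoly_ring A" by fact
  show "P \<subseteq> mpolys A" using P.a_subset by (simp add: mpoly_ring_simps)
  show "0 \<in> P" using additive_subgroup.zero_closed[OF P.is_additive_subgroup] by (simp add: mpoly_ring_simps)
  show "\<And>p q. p \<in> P \<Longrightarrow> q \<in> P \<Longrightarrow> p + q \<in> P" using additive_subgroup.a_closed[OF P.is_additive_subgroup] by (simp add: mpoly_ring_simps)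
  show mult: "\<And>p q. p \<in> P \<Longrightarrow> q \<in> mpolys A \<Longrightarrow> q * p \<in> P"
    using P.I_l_closed by (simp add: mpoly_ring_simps)
  show "\<And>p q. p \<in> mpolys A \<Longrightarrow> q \<in> mpolys A \<Longrightarrow> p * q \<in> P \<Longrightarrow> p \<in> P \<or> q \<in> P"
    using P.I_prime by (simp add: mpoly_ring_simps)
  show "mpoly_const c \<notin> P" if "c \<noteq> 0" for c
  proof
    assume "mpoly_const c \<in> P"
    then have "mpoly_const (inverse c) * mpoly_const c \<in> P" by (intro mult mpolys_const)
    then have "1 \<in> P" using that by (simp add: mult_single)
    then have "mpolys A \<subseteq> P" using mult[of 1] by auto
    then show False using P.I_notcarr \<open>P \<subseteq> mpolys A\<close> by (simp add: mpoly_ring_simps)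
  qed
qed

text \<open>
  Consider a nontrivial combination of monomials in \<open>p\<^sub>j, \<dots>, p\<^sub>n\<^sub>-\<^sub>1\<close> that lies in \<open>P\<^sub>j\<close>. The lowest power of \<open>p\<^sub>j\<close> in it can be
  divided out, since \<open>p\<^sub>j \<notin> P\<^sub>j\<close>. What remains is a combination of monomials in the later \<open>p\<^sub>i\<close> alone plus a multiple of
  \<open>p\<^sub>j \<in> P\<^sub>j\<^sub>+\<^sub>1\<close>; so the former lies in \<open>P\<^sub>j\<^sub>+\<^sub>1\<close>. At the end, a nonzero constant would lie in \<open>P\<^sub>n\<close>. In particular, the images of
  \<open>p\<^sub>0, \<dots>, p\<^sub>n\<^sub>-\<^sub>1\<close> modulo \<open>P\<^sub>0\<close> are algebraically independent.
\<close>

lemma prime_chain_independent: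
  fixes P :: "nat \<Rightarrow> ('x, 'k::field) mpoly set"
  assumes prime: "\<And>i. i \<le> n \<Longrightarrow> primeideal (P i) (mpoly_ring A)"
    and p: "\<And>i. i < n \<Longrightarrow> p i \<in> P (Suc i) \<and> p i \<notin> P i"
    and chain: "\<And>i. i < n \<Longrightarrow> P i \<subseteq> P (Suc i)"
    and U: "finite U" "U \<noteq> {}" "inj_on (\<lambda>u. restrict u {j..<n}) U" "\<And>u. u \<in> U \<Longrightarrow> c u \<noteq> 0"
    and "j \<le> n"
  shows "(\<Sum>u\<in>U. mpoly_const (c u) * (\<Prod>i=j..<n. p i ^ u i)) \<notin> P j"
  using \<open>j \<le> n\<close> U
proof (induction j arbitrary: U rule: inc_induct)
  case base
  then obtain u where "u \<in> U" by blast
  moreover have "u = v" if "v \<in> U" for v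
    using base that \<open>u \<in> U\<close> by (auto simp: inj_on_def restrict_def)
  ultimately have "U = {u}" by blast
  then show ?case
    using mpoly_primeidealD(6)[OF prime[OF order_refl], of "c u"] base by simp
next
  case (step j)
  note P = mpoly_primeidealD[OF prime[of j]] and P' = mpoly_primeidealD[OF prime[of "Suc j"]]
  have j: "j \<le> n" "Suc j \<le> n" using step.hyps by auto
  have carr: "p i \<in> mpolys A" if "i < n" for i
    using mpoly_primeidealD(1)[OF prime[of "Suc i"]] p[OF that] that by auto
  define m where "m = Min ((\<lambda>u. u j) ` U)"
  have m: "m \<le> u j" if "u \<in> U" for u using step.prems that by (auto simp: m_def)
  define U0 where "U0 = {u \<in> U. u j = m}"
  define M where "M u = mpoly_const (c u) * (\<Prod>i=Suc j..<n. p i ^ u i)" for u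
  have M: "M u \<in> mpolys A" for u
    unfolding M_def by (intro keys_mult_vars mpolys_const mpolys_prod mpolys_power carr) auto
  have "m \<in> (\<lambda>u. u j) ` U" unfolding m_def using step.prems by (intro Min_in) auto
  then have ne: "U0 \<noteq> {}" by (auto simp: U0_def)
  have inj: "inj_on (\<lambda>u. restrict u {Suc j..<n}) U0"
  proof (rule inj_onI)
    fix u v assume uv: "u \<in> U0" "v \<in> U0" "restrict u {Suc j..<n} = restrict v {Suc j..<n}"
    have "u i = v i" if "i \<in> {j..<n}" for i
    proof (cases "i = j")
      case False
      then have "i \<in> {Suc j..<n}" using that by auto
      then show ?thesis using fun_cong[OF uv(3), of i] by simp
    qed (use uv in \<open>auto simp: U0_def\<close>)
    then have "restrict u {j..<n} = restrict v {j..<n}" by (auto simp: restrict_def)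
    then show "u = v"
      by (rule inj_onD[OF step.prems(3)]) (use uv in \<open>simp_all add: U0_def\<close>)
  qed
  have "(\<Sum>u\<in>U0. M u) \<notin> P (Suc j)"
    unfolding M_def by (rule step.IH[OF _ ne inj]) (use step.prems(1,4) in \<open>auto simp: U0_def\<close>)
  have split: "(\<Sum>u\<in>U. mpoly_const (c u) * (\<Prod>i=j..<n. p i ^ u i)) =
      p j ^ m * (\<Sum>u\<in>U. p j ^ (u j - m) * M u)"
    unfolding sum_distrib_left M_def
  proof (intro sum.cong refl)
    fix u assume "u \<in> U"
    then have "p j ^ u j = p j ^ m * p j ^ (u j - m)" using m by (simp flip: power_add)
    then show "mpoly_const (c u) * (\<Prod>i=j..<n. p i ^ u i) =
        p j ^ m * (p j ^ (u j - m) * (mpoly_const (c u) * (\<Prod>i=Suc j..<n. p i ^ u i)))"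
      using step.hyps by (simp add: prod.atLeast_Suc_lessThan mult_ac)
  qed
  have sum_in_P: "sum f B \<in> P (Suc j)" if "\<And>b. b \<in> B \<Longrightarrow> f b \<in> P (Suc j)"
    for f :: "(nat \<Rightarrow> nat) \<Rightarrow> ('x, 'k) mpoly" and B
    using that by (induction B rule: infinite_finite_induct) (auto simp: P'(2)[OF j(2)] intro: P'(3)[OF j(2)])
  show ?case
  proof
    assume "(\<Sum>u\<in>U. mpoly_const (c u) * (\<Prod>i=j..<n. p i ^ u i)) \<in> P j"
    then have in_P: "p j ^ m * (\<Sum>u\<in>U. p j ^ (u j - m) * M u) \<in> P j"
      by (simp add: split)
    have cancel: "q \<in> P j" if "p j ^ k * q \<in> P j" "q \<in> mpolys A" for k q
      using that
    proof (induction k)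
      case (Suc k)
      have "p j * (p j ^ k * q) \<in> P j" using Suc.prems by (simp add: mult_ac)
      then have "p j ^ k * q \<in> P j"
        using P(5)[OF j(1) carr[OF step.hyps(2)], of "p j ^ k * q"] p[OF step.hyps(2)] Suc.prems
        by (auto intro: keys_mult_vars mpolys_power carr[OF step.hyps(2)])
      then show ?case using Suc by blast
    qed simp
    have "(\<Sum>u\<in>U. p j ^ (u j - m) * M u) \<in> P j"
      by (rule cancel[OF in_P]) (intro mpolys_sum keys_mult_vars mpolys_power carr step.hyps M)
    then have total: "(\<Sum>u\<in>U. p j ^ (u j - m) * M u) \<in> P (Suc j)"
      using chain[OF step.hyps(2)] by blast
    have rest: "(\<Sum>u\<in>U - U0. p j ^ (u j - m) * M u) \<in> P (Suc j)"
    proof (rule sum_in_P)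
      fix u assume "u \<in> U - U0"
      then have "u j - m = Suc (u j - m - 1)" using m[of u] by (auto simp: U0_def)
      then have "p j ^ (u j - m) * M u = (p j ^ (u j - m - 1) * M u) * p j"
        by (metis mult.commute mult.left_commute power_Suc)
      then show "p j ^ (u j - m) * M u \<in> P (Suc j)"
        using P'(4)[OF j(2), of "p j" "p j ^ (u j - m - 1) * M u"] p[OF step.hyps(2)]
          keys_mult_vars[OF mpolys_power[OF carr[OF step.hyps(2)]] M] by metis
    qed
    have "(\<Sum>u\<in>U. p j ^ (u j - m) * M u) =
        (\<Sum>u\<in>U - U0. p j ^ (u j - m) * M u) + (\<Sum>u\<in>U0. p j ^ (u j - m) * M u)"
      using step.prems by (intro sum.subset_diff) (auto simp: U0_def)
    also have "(\<Sum>u\<in>U0. p j ^ (u j - m) * M u) = (\<Sum>u\<in>U0. M u)"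
      by (intro sum.cong refl) (simp add: U0_def)
    finally have "(\<Sum>u\<in>U0. M u) =
        (\<Sum>u\<in>U. p j ^ (u j - m) * M u) + (- 1) * (\<Sum>u\<in>U - U0. p j ^ (u j - m) * M u)"
      by simp
    also have "\<dots> \<in> P (Suc j)"
      using total rest mpolys_uminus[OF mpolys_1] by (intro P'(3,4)[OF j(2)])
    finally show False using \<open>(\<Sum>u\<in>U0. M u) \<notin> P (Suc j)\<close> by blast
  qed
qed

lemma monom_degree_add: "monom_degree (m + n) = monom_degree m + monom_degree n"
proof -
  let ?B = "Poly_Mapping.keys m \<union> Poly_Mapping.keys n"
  have *: "monom_degree l = (\<Sum>x\<in>?B. Poly_Mapping.lookup l x)" if "Poly_Mapping.keys l \<subseteq> ?B" for l
    unfolding monom_degree_def using that by (intro sum.mono_neutral_left) (auto simp: in_keys_iff)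
  show ?thesis
    unfolding *[OF keys_add] *[OF Un_upper1] *[OF Un_upper2] by (simp add: lookup_add sum.distrib)
qed

lemma degree_le_mult:
  fixes p q :: "('x, 'k::comm_ring_1) mpoly"
  assumes "\<forall>m\<in>Poly_Mapping.keys p. monom_degree m \<le> a" "\<forall>m\<in>Poly_Mapping.keys q. monom_degree m \<le> b"
  shows "\<forall>m\<in>Poly_Mapping.keys (p * q). monom_degree m \<le> a + b"
proof
  fix m assume "m \<in> Poly_Mapping.keys (p * q)"
  then obtain u v where "m = u + v" "u \<in> Poly_Mapping.keys p" "v \<in> Poly_Mapping.keys q"
    using keys_mult[of p q] by blast
  then show "monom_degree m \<le> a + b"
    using assms by (auto simp: monom_degree_add intro: add_mono)
qed

lemma degree_le_1: "\<forall>m\<in>Poly_Mapping.keys (1 :: ('x, 'k::comm_ring_1) mpoly). monom_degree m \<le> 0"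
  by (simp add: monom_degree_def)

lemma degree_le_power:
  fixes p :: "('x, 'k::comm_ring_1) mpoly"
  assumes "\<forall>m\<in>Poly_Mapping.keys p. monom_degree m \<le> a"
  shows "\<forall>m\<in>Poly_Mapping.keys (p ^ k). monom_degree m \<le> k * a"
proof (induction k)
  case (Suc k)
  show ?case using degree_le_mult[OF assms Suc] by simp
qed (use degree_le_1 in simp)

lemma degree_le_prod:
  fixes p :: "'i \<Rightarrow> ('x, 'k::comm_ring_1) mpoly"
  assumes "\<And>i. i \<in> B \<Longrightarrow> \<forall>m\<in>Poly_Mapping.keys (p i). monom_degree m \<le> a i"
  shows "\<forall>m\<in>Poly_Mapping.keys (\<Prod>i\<in>B. p i). monom_degree m \<le> (\<Sum>i\<in>B. a i)"
  using assms
proof (induction B rule: infinite_finite_induct)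
  case (insert i B)
  have "\<forall>m\<in>Poly_Mapping.keys (p i * (\<Prod>i\<in>B. p i)). monom_degree m \<le> a i + (\<Sum>i\<in>B. a i)"
    by (intro degree_le_mult insert) auto
  then show ?case using insert by simp
qed (use degree_le_1 in simp_all)

text \<open>
  The \<open>(s + 1)\<^sup>n\<close> monomials with exponents at most \<open>s\<close> in elements \<open>p\<^sub>i \<in> P\<^sub>i\<^sub>+\<^sub>1 - P\<^sub>i\<close> of degree at most \<open>e\<close> have degree at most
  \<open>n s e\<close>, and their images are linearly independent. So \<open>(s + 1)\<^sup>n \<le> (n s e + 1)\<^sup>D\<close> for all \<open>s\<close>, which forces \<open>n \<le> D\<close>.
\<close>

lemma prime_chain_length_le:
  fixes P :: "nat \<Rightarrow> ('v set, 'k::field) mpoly set"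
  assumes G: "finite_simple_graph G"
    and growth: "\<And>N. card (\<Union>i\<le>N. edge_degrees G i) \<le> (N + 1) ^ D"
    and prime: "\<And>i. i \<le> n \<Longrightarrow> primeideal (P i) (mpoly_ring (edges G))"
    and ideal: "toric_ideal G \<subseteq> P 0"
    and chain: "\<And>i. i < n \<Longrightarrow> P i \<subset> P (Suc i)"
  shows "n \<le> D"
proof (rule ccontr)
  assume "\<not> n \<le> D"
  have "\<forall>i. \<exists>q. i < n \<longrightarrow> q \<in> P (Suc i) \<and> q \<notin> P i" using chain by blast
  then obtain p where p: "\<And>i. i < n \<Longrightarrow> p i \<in> P (Suc i) \<and> p i \<notin> P i" by metis
  have carr: "p i \<in> mpolys (edges G)" if "i < n" for i
    using mpoly_primeidealD(1)[OF prime[of "Suc i"]] p[OF that] that by auto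
  define e where "e = Max (insert 0 (monom_degree ` (\<Union>i<n. Poly_Mapping.keys (p i))))"
  have e: "\<forall>m\<in>Poly_Mapping.keys (p i). monom_degree m \<le> e" if "i < n" for i
    unfolding e_def using that by (auto intro!: Max_ge)
  define mon where "mon u = (\<Prod>i=0..<n. p i ^ u i)" for u
  have mon: "mon u \<in> mpolys (edges G)" for u
    unfolding mon_def by (intro mpolys_prod mpolys_power carr) auto
  define g where "g u = toric_map (mon u)" for u
  interpret vs: vector_space "\<lambda>c q. mpoly_const c * q :: ('v, 'k) mpoly"
    by unfold_locales (simp_all add: algebra_simps single_add mult_single flip: mult.assoc)
  \<comment> \<open>This \<open>s\<close> is large enough for \<open>(n s e + 1)\<^sup>D \<le> (n e + 1)\<^sup>D (s + 1)\<^sup>D = s (s + 1)\<^sup>D < (s + 1)\<^bsup>D+1\<^esup>\<close>.\<close>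
  define s where "s = (n * e + 1) ^ D"
  define U :: "(nat \<Rightarrow> nat) set" where "U = PiE {0..<n} (\<lambda>_. {..s})"
  have finU: "finite U" unfolding U_def by (intro finite_PiE) auto
  define H where "H = (\<Union>i\<le>n * (s * e). edge_degrees G i)"
  have finH: "finite H" unfolding H_def using finite_edge_degrees[OF G] by auto
  \<comment> \<open>A linear relation among the images lifts to a combination in the toric ideal, which is contained in \<open>P 0\<close>.\<close>
  have comb: "T = {}" if T: "T \<subseteq> U" "\<And>u. u \<in> T \<Longrightarrow> c u \<noteq> 0" "(\<Sum>u\<in>T. mpoly_const (c u) * g u) = 0" for T c
  proof (rule ccontr)
    assume "T \<noteq> {}"
    have inj: "inj_on (\<lambda>u. restrict u {0..<n}) T"
    proof (rule inj_onI)
      fix u v assume "u \<in> T" "v \<in> T" "restrict u {0..<n} = restrict v {0..<n}"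
      then show "u = v" using T(1) PiE_restrict unfolding U_def by (metis subsetD)
    qed
    have "(\<Sum>u\<in>T. mpoly_const (c u) * (\<Prod>i=0..<n. p i ^ u i)) \<notin> P 0"
      using prime p chain T(2)
      by (intro prime_chain_independent[where P = P and p = p and n = n and c = c and A = "edges G",
            OF _ _ _ finite_subset[OF T(1) finU] \<open>T \<noteq> {}\<close> inj]) blast+
    moreover have "toric_map (\<Sum>u\<in>T. mpoly_const (c u) * mon u) = 0"
      using T(3) by (simp add: toric_map_def mpoly_subst_sum mpoly_subst_mult mpoly_subst_const g_def)
    then have "(\<Sum>u\<in>T. mpoly_const (c u) * mon u) \<in> toric_ideal G"
      by (simp add: mem_toric_ideal_iff mpolys_sum keys_mult_vars mpolys_const mon)
    ultimately show False using ideal by (auto simp: mon_def)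
  qed
  have inj: "inj_on g U"
  proof (rule inj_onI, rule ccontr)
    fix u v assume uv: "u \<in> U" "v \<in> U" "g u = g v" "u \<noteq> v"
    have "{u, v} = {}"
      by (rule comb[of _ "\<lambda>w. if w = u then 1 else - 1"])
         (use uv in \<open>auto simp: single_uminus[symmetric]\<close>)
    then show False by simp
  qed
  have "vs.independent (g ` U)"
  proof
    assume "vs.dependent (g ` U)"
    then obtain t a v where t: "finite t" "t \<subseteq> g ` U" "(\<Sum>w\<in>t. mpoly_const (a w) * w) = 0" "v \<in> t" "a v \<noteq> 0"
      unfolding vs.dependent_explicit by blast
    define T where "T = {u \<in> U. g u \<in> t \<and> a (g u) \<noteq> 0}"
    have "(\<Sum>u\<in>T. mpoly_const (a (g u)) * g u) = (\<Sum>w\<in>g ` T. mpoly_const (a w) * w)"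
      using inj by (subst sum.reindex) (auto simp: T_def inj_on_def)
    also have "\<dots> = (\<Sum>w\<in>t. mpoly_const (a w) * w)"
    proof (intro sum.mono_neutral_left)
      show "\<forall>w\<in>t - g ` T. mpoly_const (a w) * w = 0"
        using t(2) unfolding T_def by force
    qed (use t(1) in \<open>auto simp: T_def\<close>)
    finally have "(\<Sum>u\<in>T. mpoly_const (a (g u)) * g u) = 0" using t(3) by simp
    then have "T = {}" by (rule comb[rotated 2]) (auto simp: T_def)
    then show False using t(2,4,5) unfolding T_def by blast
  qed
  moreover have "g ` U \<subseteq> vs.span ((\<lambda>h. Poly_Mapping.single h 1) ` H)"
  proof
    fix w assume "w \<in> g ` U"
    then obtain u where u: "u \<in> U" "w = g u" by blast
    have "\<forall>m\<in>Poly_Mapping.keys (mon u). monom_degree m \<le> (\<Sum>i=0..<n. u i * e)"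
      unfolding mon_def by (intro degree_le_prod degree_le_power e) auto
    moreover have "(\<Sum>i=0..<n. u i * e) \<le> (\<Sum>i=0..<n. s * e)"
      using u by (intro sum_mono mult_right_mono) (auto simp: U_def)
    ultimately have "Poly_Mapping.keys w \<subseteq> H"
      using keys_toric_map[of "mon u"] mon[of u] unfolding u(2) g_def H_def edge_degrees_def mpolys_def
      by fastforce
    then have "(\<Sum>h\<in>Poly_Mapping.keys w. mpoly_const (Poly_Mapping.lookup w h) * Poly_Mapping.single h 1)
        \<in> vs.span ((\<lambda>h. Poly_Mapping.single h 1) ` H)"
      by (intro vs.span_sum vs.span_scale vs.span_base) auto
    then show "w \<in> vs.span ((\<lambda>h. Poly_Mapping.single h 1) ` H)"
      by (simp add: mult_single flip: mpoly_sum_monomials)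
  qed
  ultimately have "card (g ` U) \<le> card ((\<lambda>h. Poly_Mapping.single h (1 :: 'k)) ` H)"
    using vs.independent_span_bound finH by blast
  also have "\<dots> \<le> card H" by (rule card_image_le[OF finH])
  also have "\<dots> \<le> (n * (s * e) + 1) ^ D" unfolding H_def by (rule growth)
  also have "\<dots> \<le> ((n * e + 1) * (s + 1)) ^ D"
    by (intro power_mono) (auto simp: algebra_simps)
  also have "\<dots> = s * (s + 1) ^ D" by (simp only: power_mult_distrib s_def)
  also have "\<dots> < (s + 1) ^ Suc D" by simp
  also have "\<dots> \<le> (s + 1) ^ n" using \<open>\<not> n \<le> D\<close> by (intro power_increasing) auto
  also have "\<dots> = card U" by (simp add: U_def card_PiE)
  also have "\<dots> = card (g ` U)" by (rule card_image[OF inj, symmetric])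
  finally show False by simp
qed

section \<open>Primes from faces\<close>

text \<open>
  These are the faces of the edge cone, phrased through monomials: whether an edge monomial is supported in
  \<open>F\<close> depends only on its image under the toric map.
\<close>

definition is_face :: "'v ugraph \<Rightarrow> 'v set set \<Rightarrow> bool" where
  "is_face G F \<longleftrightarrow> F \<subseteq> edges G \<and>
     (\<forall>m n. Poly_Mapping.keys m \<subseteq> edges G \<longrightarrow> Poly_Mapping.keys n \<subseteq> edges G \<longrightarrow>
        vdeg m = vdeg n \<longrightarrow> Poly_Mapping.keys m \<subseteq> F \<longrightarrow> Poly_Mapping.keys n \<subseteq> F)"

lemma is_faceD:
  assumes "is_face G F" "Poly_Mapping.keys m \<subseteq> edges G" "Poly_Mapping.keys n \<subseteq> edges G"
    "vdeg m = vdeg n" "Poly_Mapping.keys m \<subseteq> F"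
  shows "Poly_Mapping.keys n \<subseteq> F"
  using assms unfolding is_face_def by blast

definition face_ideal :: "'v ugraph \<Rightarrow> 'v set set \<Rightarrow> ('v set, 'k::field) mpoly set" where
  "face_ideal G F = {p \<in> mpolys (edges G). face_map F p = 0}"

lemma toric_ideal_eq_face_ideal: "toric_ideal G = face_ideal G UNIV"
  by (auto simp: mem_toric_ideal_iff face_ideal_def toric_map_eq_face_map)

text \<open>
  The ideal is the kernel of a homomorphism to a polynomial ring. The order on the vertices makes this
  ring an instance of the class of integral domains.
\<close>

lemma primeideal_face_ideal:
  "primeideal (face_ideal G F :: ('v::linorder set, 'k::field) mpoly set) (mpoly_ring (edges G))"
proof (rule primeidealI)
  let ?R = "mpoly_ring (edges G) :: ('v set, 'k) mpoly ring" and ?S = "mpoly_ring UNIV :: ('v, 'k) mpoly ring"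
  let ?J = "face_ideal G F :: ('v set, 'k) mpoly set"
  have one: "face_map F (1 :: ('v set, 'k) mpoly) = 1"
    using face_map_const[of F "1 :: 'k"] by simp
  have "face_map F p \<in> carrier ?S" for p :: "('v set, 'k) mpoly"
    by (simp add: mpoly_ring_simps mpolys_def)
  then have "face_map F \<in> ring_hom ?R ?S"
    by (intro ring_hom_memI) (simp_all add: mpoly_ring_simps face_map_add face_map_mult one)
  then have "ring_hom_ring ?R ?S (face_map F)"
    by (rule ring_hom_ringI2[OF cring.axioms(1)[OF cring_mpoly_ring] cring.axioms(1)[OF cring_mpoly_ring]])
  then have "ideal (a_kernel ?R ?S (face_map F)) ?R" by (rule ring_hom_ring.kernel_is_ideal)
  also have "a_kernel ?R ?S (face_map F) = ?J"
    unfolding a_kernel_def' face_ideal_def mpoly_ring_simps ..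
  finally show "ideal ?J ?R" .
  have "1 \<notin> ?J" by (simp add: face_ideal_def one)
  then show "carrier ?R \<noteq> ?J"
    using mpolys_1[of "edges G"] unfolding mpoly_ring_simps by metis
  show "p \<in> ?J \<or> q \<in> ?J"
    if "p \<in> carrier ?R" "q \<in> carrier ?R" "p \<otimes>\<^bsub>?R\<^esub> q \<in> ?J" for p q
  proof -
    have "face_map F p * face_map F q = 0"
      using that unfolding mpoly_ring_simps face_ideal_def by (simp add: face_map_mult)
    then have "face_map F p = 0 \<or> face_map F q = 0" by simp
    then show ?thesis using that unfolding mpoly_ring_simps face_ideal_def by blast
  qed
qed (rule cring_mpoly_ring)

text \<open>
  Over each vertex monomial either all edge monomials or none are supported in the face \<open>F'\<close>. So a coefficient of
  \<open>face_map F' p\<close> is either zero or equal to the one of \<open>face_map F p\<close>.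
\<close>

lemma face_ideal_mono:
  assumes F': "is_face G F'" and "F' \<subseteq> F"
  shows "face_ideal G F \<subseteq> face_ideal G F'"
proof
  fix p :: "('a set, 'b) mpoly" assume "p \<in> face_ideal G F"
  then have p: "p \<in> mpolys (edges G)" and 0: "face_map F p = 0" by (auto simp: face_ideal_def)
  have "Poly_Mapping.lookup (face_map F' p) h = 0" for h
  proof (cases "\<exists>m\<in>Poly_Mapping.keys p. Poly_Mapping.keys m \<subseteq> F' \<and> vdeg m = h")
    case True
    then obtain m where m: "m \<in> Poly_Mapping.keys p" "Poly_Mapping.keys m \<subseteq> F'" "vdeg m = h" by blast
    have edges: "Poly_Mapping.keys l \<subseteq> edges G" if "l \<in> Poly_Mapping.keys p" for l
      using p that by (auto simp: mpolys_def)
    have "Poly_Mapping.keys n \<subseteq> F'" if "n \<in> Poly_Mapping.keys p" "vdeg n = h" for n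
      by (rule is_faceD[OF F' edges[OF m(1)] edges[OF that(1)] _ m(2)]) (simp add: m(3) that(2))
    then have "{m \<in> Poly_Mapping.keys p. Poly_Mapping.keys m \<subseteq> F' \<and> vdeg m = h} =
        {m \<in> Poly_Mapping.keys p. Poly_Mapping.keys m \<subseteq> F \<and> vdeg m = h}"
      using assms(2) by (intro Collect_cong) (metis order_trans)
    then have "Poly_Mapping.lookup (face_map F' p) h = Poly_Mapping.lookup (face_map F p) h"
      by (simp add: lookup_face_map)
    then show ?thesis by (simp add: 0)
  next
    case False
    then have "{m \<in> Poly_Mapping.keys p. Poly_Mapping.keys m \<subseteq> F' \<and> vdeg m = h} = {}" by blast
    then show ?thesis by (simp only: lookup_face_map) simp
  qed
  then have "face_map F' p = 0" by (intro poly_mapping_eqI) simp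
  then show "p \<in> face_ideal G F'" using p by (simp add: face_ideal_def)
qed

lemma face_ideal_strict_mono:
  assumes "is_face G F'" "is_face G F" "F' \<subset> F"
  shows "(face_ideal G F :: ('v set, 'k::field) mpoly set) \<subset> face_ideal G F'"
proof -
  obtain e where e: "e \<in> F" "e \<notin> F'" using assms by blast
  let ?x = "mpoly_var e :: ('v set, 'k) mpoly"
  have "e \<in> edges G" using e assms(2) by (auto simp: is_face_def)
  then have x: "?x \<in> mpolys (edges G)" by (simp add: mpolys_def)
  have "face_map F ?x = Poly_Mapping.single (vdeg (Poly_Mapping.single e 1)) 1"
    using e by (simp add: face_map_single)
  then have "Poly_Mapping.lookup (face_map F ?x) (vdeg (Poly_Mapping.single e 1)) \<noteq> 0" by simp
  then have "face_map F ?x \<noteq> 0" by (metis lookup_zero)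
  then have "?x \<notin> face_ideal G F" by (simp add: face_ideal_def)
  moreover have "?x \<in> face_ideal G F'" using e x by (simp add: face_ideal_def face_map_single)
  moreover have "face_ideal G F \<subseteq> (face_ideal G F' :: ('v set, 'k) mpoly set)"
    using face_ideal_mono[OF assms(1)] assms(3) by blast
  ultimately show ?thesis by blast
qed

text \<open>
  The upper bound is \<open>prime_chain_length_le\<close>. The ideals of the faces form a chain of primes that attains it.
\<close>

proposition krull_dim_toric:
  fixes G :: "'v::linorder ugraph" and I :: "('v set, 'k::field) mpoly set"
  assumes G: "finite_simple_graph G" and I: "I = toric_ideal G"
    and growth: "\<And>N. card (\<Union>i\<le>N. edge_degrees G i) \<le> (N + 1) ^ D"
    and faces: "\<And>i. i \<le> D \<Longrightarrow> is_face G (F i)" "\<And>i. i < D \<Longrightarrow> F (Suc i) \<subset> F i"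
  shows "krull_dim (mpoly_ring (edges G) Quot I) = enat D"
proof -
  have ideal: "ideal I (mpoly_ring (edges G))" unfolding I by (rule ideal_toric_ideal[OF G])
  let ?chains = "{enat n |n. \<exists>P. (\<forall>i\<le>n. primeideal (P i) (mpoly_ring (edges G)) \<and> I \<subseteq> P i) \<and>
      (\<forall>i<n. P i \<subset> P (Suc i))}"
  have upper: "Sup ?chains \<le> enat D"
  proof (rule Sup_least)
    fix l assume "l \<in> ?chains"
    then obtain n and P :: "nat \<Rightarrow> ('v set, 'k) mpoly set"
      where l: "l = enat n" and "\<forall>i\<le>n. primeideal (P i) (mpoly_ring (edges G)) \<and> I \<subseteq> P i"
        and "\<forall>i<n. P i \<subset> P (Suc i)"
      by blast
    then have "n \<le> D"
      by (intro prime_chain_length_le[OF G growth, of n P]) (simp_all add: I)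
    then show "l \<le> enat D" by (simp add: l)
  qed
  have "\<forall>i\<le>D. primeideal (face_ideal G (F i)) (mpoly_ring (edges G)) \<and> I \<subseteq> face_ideal G (F i)"
    unfolding I toric_ideal_eq_face_ideal
    by (intro allI impI conjI primeideal_face_ideal face_ideal_mono faces subset_UNIV)
  moreover have "\<forall>i<D. (face_ideal G (F i) :: ('v set, 'k) mpoly set) \<subset> face_ideal G (F (Suc i))"
    using faces by (intro allI impI face_ideal_strict_mono) auto
  ultimately have "enat D \<in> ?chains"
    by (intro CollectI exI[of _ D] exI[of _ "\<lambda>i. face_ideal G (F i)"] conjI refl)
  then have "enat D \<le> Sup ?chains" by (rule Sup_upper)
  then show ?thesis
    unfolding krull_dim_quot[OF cring_mpoly_ring ideal] using upper by (rule antisym[rotated])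
qed

section \<open>Generating functions of weighted sets\<close>

definition weight_series :: "'a set \<Rightarrow> ('a \<Rightarrow> nat) \<Rightarrow> rat fps" where
  "weight_series S w = Abs_fps (\<lambda>n. of_nat (card {s \<in> S. w s = n}))"

lemma weight_series_nth: "fps_nth (weight_series S w) n = of_nat (card {s \<in> S. w s = n})"
  by (simp add: weight_series_def)

lemma weight_series_bij:
  assumes "bij_betw f S T" "\<And>s. s \<in> S \<Longrightarrow> w' (f s) = w s"
  shows "weight_series T w' = weight_series S w"
proof (rule fps_ext)
  fix n
  have "bij_betw f {s \<in> S. w s = n} {t \<in> T. w' t = n}"
    using assms by (auto simp: bij_betw_def inj_on_def)
  then show "fps_nth (weight_series T w') n = fps_nth (weight_series S w) n"
    by (simp add: weight_series_nth bij_betw_same_card)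
qed

lemma weight_series_Un:
  assumes "\<And>n. finite {s \<in> S. w s = n}" "\<And>n. finite {t \<in> T. w t = n}" "S \<inter> T = {}"
  shows "weight_series (S \<union> T) w = weight_series S w + weight_series T w"
proof (rule fps_ext)
  fix n
  have "{s \<in> S \<union> T. w s = n} = {s \<in> S. w s = n} \<union> {t \<in> T. w t = n}" by blast
  moreover have "{s \<in> S. w s = n} \<inter> {t \<in> T. w t = n} = {}" using assms by blast
  ultimately show "fps_nth (weight_series (S \<union> T) w) n = fps_nth (weight_series S w + weight_series T w) n"
    using assms by (simp add: weight_series_nth card_Un_disjoint)
qed

lemma weight_series_Times:
  assumes "\<And>n. finite {s \<in> S. w s = n}" "\<And>n. finite {t \<in> T. w' t = n}"
  shows "weight_series (S \<times> T) (\<lambda>(s, t). w s + w' t) = weight_series S w * weight_series T w'"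
proof (rule fps_ext)
  fix n
  let ?F = "\<lambda>i. {s \<in> S. w s = i} \<times> {t \<in> T. w' t = n - i}"
  have "{p \<in> S \<times> T. (\<lambda>(s, t). w s + w' t) p = n} = (\<Union>i\<in>{0..n}. ?F i)" by auto
  moreover have "card (\<Union>i\<in>{0..n}. ?F i) = (\<Sum>i=0..n. card (?F i))"
    using assms by (intro card_UN_disjoint) auto
  ultimately show "fps_nth (weight_series (S \<times> T) (\<lambda>(s, t). w s + w' t)) n =
      fps_nth (weight_series S w * weight_series T w') n"
    by (simp add: weight_series_nth fps_mult_nth card_cartesian_product)
qed

lemma weight_series_shift: "weight_series S (\<lambda>s. w s + k) = fps_X ^ k * weight_series S w"
proof (rule fps_ext)
  fix n
  have "{s \<in> S. w s + k = n} = (if n < k then {} else {s \<in> S. w s = n - k})" by auto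
  then show "fps_nth (weight_series S (\<lambda>s. w s + k)) n = fps_nth (fps_X ^ k * weight_series S w) n"
    by (simp add: weight_series_nth fps_X_power_mult_nth)
qed

text \<open>
  The series \<open>1/(1 - t)\<close>.
\<close>

definition geom :: "rat fps" where
  "geom = Abs_fps (\<lambda>_. 1)"

lemma geom_mult: "geom * (1 - fps_X) = 1"
  by (rule fps_ext) (auto simp: geom_def algebra_simps)

lemma geom_power_mult: "geom ^ n * (1 - fps_X) ^ n = 1"
  by (simp add: geom_mult flip: power_mult_distrib)

lemma fps_deriv_geom_power: "fps_deriv (geom ^ n) = of_nat n * geom ^ (n + 1)"
proof -
  have "fps_deriv (geom * (1 - fps_X)) = 0" by (simp add: geom_mult)
  then have "fps_deriv geom * (1 - fps_X) = geom" by (simp add: algebra_simps)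
  then have "fps_deriv geom * (geom * (1 - fps_X)) = geom * geom"
    by (metis mult.assoc mult.commute)
  then have "fps_deriv geom = geom * geom" by (simp add: geom_mult)
  then show ?thesis by (induction n) (simp_all add: algebra_simps)
qed

definition exponents :: "'x set \<Rightarrow> ('x \<Rightarrow> nat) set" where
  "exponents A = {f. \<forall>x. x \<notin> A \<longrightarrow> f x = 0}"

lemma finite_exponents:
  assumes "finite A"
  shows "finite {f \<in> exponents A. sum f A = n}"
proof (rule finite_subset)
  show "{f \<in> exponents A. sum f A = n} \<subseteq> {f. \<forall>x. (x \<in> A \<longrightarrow> f x \<in> {..n}) \<and> (x \<notin> A \<longrightarrow> f x = 0)}"
    using assms by (auto simp: exponents_def intro: member_le_sum)
qed (use assms in \<open>intro finite_set_of_finite_funs, auto\<close>)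

lemma weight_series_exponents:
  assumes "finite A"
  shows "weight_series (exponents A) (\<lambda>f. sum f A) = geom ^ card A"
  using assms
proof (induction A rule: finite_induct)
  case empty
  have "exponents ({} :: 'a set) = {\<lambda>_. 0}" by (auto simp: exponents_def)
  then show ?case
    by (intro fps_ext) (simp add: weight_series_nth fps_one_nth Collect_conv_if)
next
  case (insert a A)
  have geom: "weight_series (UNIV :: nat set) (\<lambda>k. k) = geom"
    by (rule fps_ext) (simp add: weight_series_nth geom_def Collect_conv_if)
  have sum_upd: "(\<Sum>x\<in>A. if x = a then k else f x) = sum f A" for f :: "'a \<Rightarrow> nat" and k
    using insert.hyps by (intro sum.cong) auto
  have "bij_betw (\<lambda>(k, f). f(a := k)) (UNIV \<times> exponents A) (exponents (insert a A))"
    by (rule bij_betw_byWitness[where f' = "\<lambda>f. (f a, f(a := 0))"])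
       (use insert.hyps in \<open>auto simp: exponents_def fun_eq_iff\<close>)
  then have "weight_series (exponents (insert a A)) (\<lambda>f. sum f (insert a A)) =
      weight_series (UNIV \<times> exponents A) (\<lambda>(k, f). k + sum f A)"
    by (rule weight_series_bij) (use insert.hyps in \<open>auto simp: sum_upd\<close>)
  also have "\<dots> = geom * geom ^ card A"
    using insert finite_exponents[of A] geom by (subst weight_series_Times) auto
  finally show ?case using insert.hyps by simp
qed

text \<open>
  Choosing one of the \<open>w s\<close> units of weight multiplies the number of elements of weight \<open>n\<close> by \<open>n\<close>.
\<close>

lemma weight_series_marked:
  assumes "\<And>n. finite {s \<in> S. w s = n}"
  shows "weight_series {(s, q). s \<in> S \<and> 1 \<le> q \<and> q \<le> w s} (\<lambda>(s, q). w s) =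
    fps_X * fps_deriv (weight_series S w)"
proof (rule fps_ext)
  fix n
  have "{p \<in> {(s, q). s \<in> S \<and> 1 \<le> q \<and> q \<le> w s}. (\<lambda>(s, q). w s) p = n} = {s \<in> S. w s = n} \<times> {1..n}"
    by auto
  then show "fps_nth (weight_series {(s, q). s \<in> S \<and> 1 \<le> q \<and> q \<le> w s} (\<lambda>(s, q). w s)) n =
      fps_nth (fps_X * fps_deriv (weight_series S w)) n"
    by (simp add: weight_series_nth card_cartesian_product mult.commute)
qed

text \<open>
  The exponents that are positive on all of \<open>B\<close> arise from arbitrary ones by adding the indicator of \<open>B\<close>, which has
  weight \<open>card B\<close>.
\<close>

lemma weight_series_some_zero:
  assumes "finite A" "B \<subseteq> A"
  shows "weight_series {f \<in> exponents A. \<exists>x\<in>B. f x = 0} (\<lambda>f. sum f A) =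
    geom ^ card A - fps_X ^ card B * geom ^ card A"
proof -
  let ?w = "\<lambda>f :: 'a \<Rightarrow> nat. sum f A"
  let ?S = "{f \<in> exponents A. \<exists>x\<in>B. f x = 0}" and ?T = "{f \<in> exponents A. \<forall>x\<in>B. f x > 0}"
  have fin: "finite B" using assms finite_subset by blast
  have "exponents A = ?S \<union> ?T" by auto
  then have "geom ^ card A = weight_series (?S \<union> ?T) ?w"
    using weight_series_exponents[OF assms(1)] by simp
  also have "\<dots> = weight_series ?S ?w + weight_series ?T ?w"
    by (rule weight_series_Un) (auto intro: finite_subset[OF _ finite_exponents[OF assms(1)]])
  also have "weight_series ?T ?w = weight_series (exponents A) (\<lambda>f. ?w f + card B)"
  proof (rule weight_series_bij)
    show "bij_betw (\<lambda>f x. f x + of_bool (x \<in> B)) (exponents A) ?T"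
      by (rule bij_betw_byWitness[where f' = "\<lambda>f x. f x - of_bool (x \<in> B)"])
         (use assms in \<open>auto simp: exponents_def fun_eq_iff\<close>)
    fix f :: "'a \<Rightarrow> nat"
    have "(\<Sum>x\<in>A. of_bool (x \<in> B)) = card (A \<inter> B)"
      using assms(1) by (simp add: of_bool_def sum.If_cases)
    then show "sum (\<lambda>x. f x + of_bool (x \<in> B)) A = sum f A + card B"
      using assms(2) by (simp add: sum.distrib Int_absorb1)
  qed
  also have "\<dots> = fps_X ^ card B * geom ^ card A"
    by (simp add: weight_series_shift weight_series_exponents[OF assms(1)])
  finally show ?thesis by (simp add: algebra_simps)
qed

text \<open>
  A triple \<open>(c, q, e)\<close> stands for the edge monomials with \<open>c i\<close> edges at \<open>y\<^sub>i\<close>, of which \<open>q\<close> in total end at \<open>x\<^sub>2\<close>, and with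
  exponents \<open>e\<close> on the path through the \<open>z\<^sub>j\<close>. The set \<open>B\<close> will be the set of odd positions on this path; the last condition says
  that the binomial of the even cycles cannot be applied.
\<close>

definition normal_forms :: "'x set \<Rightarrow> 'y set \<Rightarrow> 'y set \<Rightarrow> (('x \<Rightarrow> nat) \<times> nat \<times> ('y \<Rightarrow> nat)) set" where
  "normal_forms C M B = {(c, q, e). c \<in> exponents C \<and> q \<le> sum c C \<and> e \<in> exponents M \<and>
     (q = 0 \<or> (\<exists>x\<in>B. e x = 0))}"

text \<open>
  The triples with \<open>q = 0\<close> are free in \<open>c\<close> and \<open>e\<close>. Those with \<open>q > 0\<close> are pairs of a \<open>c\<close> with one of its units marked and
  an \<open>e\<close> with a zero in \<open>B\<close>.
\<close>

lemma weight_series_normal_forms: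
  assumes fin: "finite C" "finite M" "B \<subseteq> M"
  shows "weight_series (normal_forms C M B) (\<lambda>(c, q, e). sum c C + sum e M) * (1 - fps_X) ^ (card C + card M) =
    1 + of_nat (card C) * fps_X * (\<Sum>i<card B. fps_X ^ i)"
proof -
  let ?w = "\<lambda>(c, q :: nat, e). sum c C + sum e M :: nat"
  let ?S0 = "(\<lambda>(c, e). (c, 0 :: nat, e)) ` (exponents C \<times> exponents M)"
  let ?mark = "{(c, q). c \<in> exponents C \<and> 1 \<le> q \<and> q \<le> sum c C}"
  let ?zero = "{e \<in> exponents M. \<exists>x\<in>B. e x = 0}"
  let ?S1 = "(\<lambda>((c, q), e). (c, q, e)) ` (?mark \<times> ?zero)"
  note finC = finite_exponents[OF fin(1)] and finM = finite_exponents[OF fin(2)]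
  have fin_mark: "finite {p \<in> ?mark. (\<lambda>(c, q). sum c C) p = n}" for n
    by (rule finite_subset[of _ "{c \<in> exponents C. sum c C = n} \<times> {..n}"]) (use finC in auto)
  have fin_zero: "finite {e \<in> ?zero. sum e M = n}" for n
    by (rule finite_subset[OF _ finM[of n]]) auto
  have S0: "weight_series ?S0 ?w = geom ^ (card C + card M)"
  proof -
    have "weight_series ?S0 ?w = weight_series (exponents C \<times> exponents M) (\<lambda>(c, e). sum c C + sum e M)"
      by (rule weight_series_bij[OF inj_on_imp_bij_betw]) (auto simp: inj_on_def)
    then show ?thesis
      by (simp add: weight_series_Times[OF finC finM] weight_series_exponents fin power_add)
  qed
  have S1: "weight_series ?S1 ?w =
      of_nat (card C) * fps_X * geom * (1 - fps_X ^ card B) * geom ^ (card C + card M)"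
  proof -
    have "weight_series ?S1 ?w = weight_series (?mark \<times> ?zero) (\<lambda>(p, e). (\<lambda>(c, q). sum c C) p + sum e M)"
      by (rule weight_series_bij[OF inj_on_imp_bij_betw]) (auto simp: inj_on_def)
    also have "\<dots> = weight_series ?mark (\<lambda>(c, q). sum c C) * weight_series ?zero (\<lambda>e. sum e M)"
      by (rule weight_series_Times[OF fin_mark fin_zero])
    also have "\<dots> = (fps_X * fps_deriv (geom ^ card C)) * (geom ^ card M - fps_X ^ card B * geom ^ card M)"
      by (simp add: weight_series_marked[OF finC, simplified] weight_series_exponents fin weight_series_some_zero)
    finally show ?thesis
      by (simp add: fps_deriv_geom_power power_add algebra_simps)
  qed
  have finite_fibre: "finite {p \<in> normal_forms C M B. ?w p = n}" for n
  proof (rule finite_subset)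
    show "{p \<in> normal_forms C M B. ?w p = n} \<subseteq>
        (\<Union>i\<le>n. {c \<in> exponents C. sum c C = i}) \<times> {..n} \<times> (\<Union>i\<le>n. {e \<in> exponents M. sum e M = i})"
      by (auto simp: normal_forms_def)
  qed (use finC finM in auto)
  \<comment> \<open>The cases \<open>q = 0\<close> and \<open>q > 0\<close>.\<close>
  have split: "normal_forms C M B = ?S0 \<union> ?S1"
    by (force simp: normal_forms_def image_iff split: prod.splits)
  have "weight_series (normal_forms C M B) ?w = weight_series ?S0 ?w + weight_series ?S1 ?w"
    unfolding split
  proof (rule weight_series_Un)
    show "finite {p \<in> ?S0. ?w p = n}" "finite {p \<in> ?S1. ?w p = n}" for n
      by (rule finite_subset[OF _ finite_fibre[of n]]; unfold split; blast)+
  qed auto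
  also have "\<dots> = (1 + of_nat (card C) * fps_X * (geom * (1 - fps_X ^ card B))) * geom ^ (card C + card M)"
    unfolding S0 S1 by (simp add: algebra_simps)
  also have "geom * (1 - fps_X ^ card B) = (\<Sum>i<card B. fps_X ^ i)"
    unfolding one_diff_power_eq[of fps_X] mult.assoc[symmetric] by (simp add: geom_mult)
  finally show ?thesis
    using geom_power_mult[of "card C + card M"] by (simp add: mult.assoc)
qed

section \<open>Growth bounds and faces from vertex exponents\<close>

lemma lookup_vdeg_graph:
  assumes "finite_simple_graph G" "Poly_Mapping.keys m \<subseteq> edges G"
  shows "Poly_Mapping.lookup (vdeg m) x = (\<Sum>e\<in>edges G. if x \<in> e then Poly_Mapping.lookup m e else 0)"
  using lookup_vdeg[OF _ assms(2)] finite_simple_graph_edges[OF assms(1)] by blast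

text \<open>
  Each edge meets \<open>S\<close> in exactly one vertex, so it contributes one to the total exponent on \<open>S\<close>.
\<close>

lemma sum_vdeg_transversal:
  assumes "finite_simple_graph G" "Poly_Mapping.keys m \<subseteq> edges G"
    and S: "finite S" "\<And>e. e \<in> edges G \<Longrightarrow> card (e \<inter> S) = 1"
  shows "(\<Sum>x\<in>S. Poly_Mapping.lookup (vdeg m) x) = monom_degree m"
proof -
  note fin = finite_simple_graph_edges[OF assms(1)]
  have "(\<Sum>x\<in>S. Poly_Mapping.lookup (vdeg m) x) =
      (\<Sum>x\<in>S. \<Sum>e\<in>edges G. if x \<in> e then Poly_Mapping.lookup m e else 0)"
    by (simp add: lookup_vdeg_graph[OF assms(1,2)])
  also have "\<dots> = (\<Sum>e\<in>edges G. \<Sum>x\<in>S. if x \<in> e then Poly_Mapping.lookup m e else 0)"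
    by (rule sum.swap)
  also have "\<dots> = (\<Sum>e\<in>edges G. Poly_Mapping.lookup m e)"
  proof (intro sum.cong refl)
    fix e assume "e \<in> edges G"
    then have "card (S \<inter> e) = 1" using S(2)[of e] by (simp add: Int_commute[of S e])
    then show "(\<Sum>x\<in>S. if x \<in> e then Poly_Mapping.lookup m e else 0) = Poly_Mapping.lookup m e"
      using S(1) by (simp flip: sum.inter_restrict)
  qed
  also have "\<dots> = monom_degree m"
    unfolding monom_degree_def using fin(1) assms(2)
    by (intro sum.mono_neutral_right) (auto simp: in_keys_iff)
  finally show ?thesis .
qed

lemma monom_degree_superset:
  assumes "finite A" "Poly_Mapping.keys m \<subseteq> A"
  shows "monom_degree m = (\<Sum>x\<in>A. Poly_Mapping.lookup m x)"
  unfolding monom_degree_def using assms by (intro sum.mono_neutral_left) (auto simp: in_keys_iff)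

text \<open>
  Both sides of the bipartition have the same total exponent in a product of edges. Hence the exponent at \<open>x0\<close> is determined by
  the others, each of which is at most \<open>N\<close>.
\<close>

lemma edge_degrees_growth_bipartite:
  assumes G: "finite_simple_graph G"
    and V: "verts G = S \<union> T" "S \<inter> T = {}" and x0: "x0 \<in> S"
    and S: "\<And>e. e \<in> edges G \<Longrightarrow> card (e \<inter> S) = 1"
    and T: "\<And>e. e \<in> edges G \<Longrightarrow> card (e \<inter> T) = 1"
  shows "card (\<Union>i\<le>N. edge_degrees G i) \<le> (N + 1) ^ (card (verts G) - 1)"
proof -
  note fin = finite_simple_graph_edges[OF G]
  have finV: "finite (verts G)" using G by (simp add: finite_simple_graph_def)
  let ?W = "verts G - {x0}" and ?H = "\<Union>i\<le>N. edge_degrees G i"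
  have H: "\<exists>m. h = vdeg m \<and> Poly_Mapping.keys m \<subseteq> edges G \<and> monom_degree m \<le> N" if "h \<in> ?H" for h
    using that by (auto simp: edge_degrees_def)
  have le: "Poly_Mapping.lookup h x \<le> N" and zero: "x \<notin> verts G \<Longrightarrow> Poly_Mapping.lookup h x = 0"
    if "h \<in> ?H" for h x
  proof -
    obtain m where m: "h = vdeg m" "Poly_Mapping.keys m \<subseteq> edges G" "monom_degree m \<le> N"
      using H[OF \<open>h \<in> ?H\<close>] by blast
    have "Poly_Mapping.lookup h x = (\<Sum>e\<in>edges G. if x \<in> e then Poly_Mapping.lookup m e else 0)"
      unfolding m(1) by (rule lookup_vdeg_graph[OF G m(2)])
    also have "\<dots> \<le> (\<Sum>e\<in>edges G. Poly_Mapping.lookup m e)" by (intro sum_mono) simp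
    also have "\<dots> = monom_degree m" by (rule monom_degree_superset[OF fin(1) m(2), symmetric])
    finally show "Poly_Mapping.lookup h x \<le> N" using m(3) by simp
    assume "x \<notin> verts G"
    then have "x \<notin> e" if "e \<in> edges G" for e
      using that G by (auto simp: finite_simple_graph_def)
    then show "Poly_Mapping.lookup h x = 0"
      unfolding m(1) lookup_vdeg_graph[OF G m(2)] by (simp cong: sum.cong)
  qed
  have "inj_on (\<lambda>h. restrict (Poly_Mapping.lookup h) ?W) ?H"
  proof (rule inj_onI, rule poly_mapping_eqI)
    fix h h' x assume h: "h \<in> ?H" "h' \<in> ?H"
      and eq: "restrict (Poly_Mapping.lookup h) ?W = restrict (Poly_Mapping.lookup h') ?W"
    have W: "Poly_Mapping.lookup h y = Poly_Mapping.lookup h' y" if "y \<in> ?W" for y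
      using fun_cong[OF eq, of y] that by (simp only: restrict_apply' if_True)
    have finST: "finite S" "finite T" using finV V by auto
    have balance: "(\<Sum>y\<in>S. Poly_Mapping.lookup g y) = (\<Sum>y\<in>T. Poly_Mapping.lookup g y)" if "g \<in> ?H" for g
      using H[OF that] sum_vdeg_transversal[OF G _ finST(1) S] sum_vdeg_transversal[OF G _ finST(2) T] by force
    have "(\<Sum>y\<in>T. Poly_Mapping.lookup h y) = (\<Sum>y\<in>T. Poly_Mapping.lookup h' y)"
      using V x0 by (intro sum.cong refl W) auto
    then have "(\<Sum>y\<in>S. Poly_Mapping.lookup h y) = (\<Sum>y\<in>S. Poly_Mapping.lookup h' y)"
      using balance h by simp
    moreover have "(\<Sum>y\<in>S - {x0}. Poly_Mapping.lookup h y) = (\<Sum>y\<in>S - {x0}. Poly_Mapping.lookup h' y)"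
      using V by (intro sum.cong refl W) auto
    ultimately have "Poly_Mapping.lookup h x0 = Poly_Mapping.lookup h' x0"
      by (simp add: sum.remove[OF finST(1) x0])
    then show "Poly_Mapping.lookup h x = Poly_Mapping.lookup h' x"
      using W[of x] zero[OF h(1), of x] zero[OF h(2), of x] by (cases "x = x0"; cases "x \<in> verts G") auto
  qed
  moreover have "(\<lambda>h. restrict (Poly_Mapping.lookup h) ?W) ` ?H \<subseteq> PiE ?W (\<lambda>_. {..N})"
    using le by (intro image_subsetI) (simp add: restrict_PiE_iff)
  ultimately have "card ?H \<le> card (PiE ?W (\<lambda>_. {..N}))"
    using finV by (intro card_inj_on_le) (auto intro: finite_PiE)
  also have "\<dots> = (N + 1) ^ (card (verts G) - 1)"
    using finV x0 V by (simp add: card_PiE card_Diff_singleton)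
  finally show ?thesis .
qed

text \<open>
  An edge monomial avoids \<open>W\<close> iff its vertex monomial has exponent zero on \<open>W\<close>.
\<close>

lemma is_face_avoiding:
  assumes G: "finite_simple_graph G"
  shows "is_face G {e \<in> edges G. e \<inter> W = {}}"
  unfolding is_face_def
proof (intro conjI allI impI)
  fix m n
  assume m: "Poly_Mapping.keys m \<subseteq> edges G" and n: "Poly_Mapping.keys n \<subseteq> edges G"
    and eq: "vdeg m = vdeg n" and avoid: "Poly_Mapping.keys m \<subseteq> {e \<in> edges G. e \<inter> W = {}}"
  note fin = finite_simple_graph_edges[OF G]
  show "Poly_Mapping.keys n \<subseteq> {e \<in> edges G. e \<inter> W = {}}"
  proof (rule subsetI, rule CollectI, rule conjI)
    fix e assume e: "e \<in> Poly_Mapping.keys n"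
    then show "e \<in> edges G" using n by blast
    show "e \<inter> W = {}"
    proof (rule ccontr)
      assume "e \<inter> W \<noteq> {}"
      then obtain x where x: "x \<in> e" "x \<in> W" by blast
      have "Poly_Mapping.lookup (vdeg m) x = 0"
        unfolding lookup_vdeg_graph[OF G m] using avoid x(2)
        by (intro sum.neutral) (auto simp: in_keys_iff)
      then have "\<forall>e\<in>edges G. (if x \<in> e then Poly_Mapping.lookup n e else 0) = 0"
        unfolding eq lookup_vdeg_graph[OF G n] using fin(1) by simp
      then have "Poly_Mapping.lookup n e = 0" using \<open>e \<in> edges G\<close> x(1) by auto
      then show False using e by (simp add: in_keys_iff)
    qed
  qed
qed blast

section \<open>Edge monomials of the graphs \<open>G_rd\<close>\<close>

definition a_edge :: "nat \<Rightarrow> vertex set" where "a_edge i = {X 1, Y i}"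
definition b_edge :: "nat \<Rightarrow> vertex set" where "b_edge i = {X 2, Y i}"
definition z_edge :: "nat \<Rightarrow> nat \<Rightarrow> vertex set" where
  "z_edge r i = (if i = 1 then {X 1, Z 1} else if i = 2 * r - 2 then {Z (2 * r - 3), X 2} else {Z (i - 1), Z i})"

definition odd_places :: "nat \<Rightarrow> nat set" where "odd_places r = {i \<in> {1..2 * r - 2}. odd i}"

text \<open>
  The vertex exponents of an edge monomial with \<open>c i\<close> edges at \<open>y\<^sub>i\<close>, of which \<open>p\<close> in total end at \<open>x\<^sub>1\<close> and \<open>q\<close> at
  \<open>x\<^sub>2\<close>, and with exponents \<open>e\<close> on the path \<open>x\<^sub>1, z\<^sub>1, \<dots>, z\<^sub>2\<^sub>r\<^sub>-\<^sub>3, x\<^sub>2\<close>. Monomials with equal data \<open>c, p, q, e\<close> differ by the relations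
  \<open>a\<^sub>i b\<^sub>j = a\<^sub>j b\<^sub>i\<close>.
\<close>

definition rd_degrees ::
    "nat \<Rightarrow> (nat \<Rightarrow> nat) \<Rightarrow> nat \<Rightarrow> nat \<Rightarrow> (nat \<Rightarrow> nat) \<Rightarrow> vertex \<Rightarrow> nat" where
  "rd_degrees r c p q e v = (case v of
      X k \<Rightarrow> if k = 1 then p + e 1 else if k = 2 then q + e (2 * r - 2) else 0
    | Y i \<Rightarrow> c i
    | Z j \<Rightarrow> if 1 \<le> j \<and> j \<le> 2 * r - 3 then e j + e (Suc j) else 0)"

lemma odd_places_eq: "odd_places r = (\<lambda>k. 2 * k + 1) ` {..<r - 1}"
proof
  show "odd_places r \<subseteq> (\<lambda>k. 2 * k + 1) ` {..<r - 1}"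
  proof
    fix i assume "i \<in> odd_places r"
    then have "odd i" "i \<le> 2 * r - 2" by (auto simp: odd_places_def)
    then obtain k where "i = 2 * k + 1" "k < r - 1" by (auto elim!: oddE)
    then show "i \<in> (\<lambda>k. 2 * k + 1) ` {..<r - 1}" by blast
  qed
qed (auto simp: odd_places_def)

lemma card_odd_places: "card (odd_places r) = r - 1"
  by (simp add: odd_places_eq card_image inj_on_def)

definition a_exp :: "nat \<Rightarrow> (vertex set \<Rightarrow>\<^sub>0 nat) \<Rightarrow> nat \<Rightarrow> nat" where
  "a_exp d m i = (if i \<in> {1..d} then Poly_Mapping.lookup m (a_edge i) else 0)"
definition b_exp :: "nat \<Rightarrow> (vertex set \<Rightarrow>\<^sub>0 nat) \<Rightarrow> nat \<Rightarrow> nat" where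
  "b_exp d m i = (if i \<in> {1..d} then Poly_Mapping.lookup m (b_edge i) else 0)"
definition z_exp :: "nat \<Rightarrow> (vertex set \<Rightarrow>\<^sub>0 nat) \<Rightarrow> nat \<Rightarrow> nat" where
  "z_exp r m i = (if i \<in> {1..2 * r - 2} then Poly_Mapping.lookup m (z_edge r i) else 0)"

lemma exps_mem:
  "a_exp d m \<in> exponents {1..d}" "b_exp d m \<in> exponents {1..d}" "z_exp r m \<in> exponents {1..2 * r - 2}"
  by (auto simp: a_exp_def b_exp_def z_exp_def exponents_def)

lemma ab_edge_incidence:
  "X k \<in> a_edge i \<longleftrightarrow> k = 1" "Y k \<in> a_edge i \<longleftrightarrow> k = i" "Z k \<notin> a_edge i"
  "X k \<in> b_edge i \<longleftrightarrow> k = 2" "Y k \<in> b_edge i \<longleftrightarrow> k = i" "Z k \<notin> b_edge i"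
  by (auto simp: a_edge_def b_edge_def)

lemma edge_distinct:
  "a_edge i = a_edge j \<longleftrightarrow> i = j" "b_edge i = b_edge j \<longleftrightarrow> i = j" "a_edge i \<noteq> b_edge j" "b_edge i \<noteq> a_edge j"
  by (auto simp: a_edge_def b_edge_def doubleton_eq_iff)

context
  fixes r d :: nat
  assumes r: "r \<ge> 3"
begin

lemma z_edge_incidence:
  assumes "i \<in> {1..2 * r - 2}"
  shows "X k \<in> z_edge r i \<longleftrightarrow> (k = 1 \<and> i = 1) \<or> (k = 2 \<and> i = 2 * r - 2)"
    "Y k \<notin> z_edge r i"
    "Z k \<in> z_edge r i \<longleftrightarrow> 1 \<le> k \<and> k \<le> 2 * r - 3 \<and> (i = k \<or> i = Suc k)"
  using assms r by (auto simp: z_edge_def)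

lemma z_edge_distinct:
  assumes "i \<in> {1..2 * r - 2}"
  shows "a_edge j \<noteq> z_edge r i" "b_edge j \<noteq> z_edge r i" "z_edge r i \<noteq> a_edge j" "z_edge r i \<noteq> b_edge j"
    and "k \<in> {1..2 * r - 2} \<Longrightarrow> z_edge r i = z_edge r k \<longleftrightarrow> i = k"
proof -
  show "a_edge j \<noteq> z_edge r i" "b_edge j \<noteq> z_edge r i" "z_edge r i \<noteq> a_edge j" "z_edge r i \<noteq> b_edge j"
    using z_edge_incidence(2)[OF assms, of j] ab_edge_incidence by auto
  show "z_edge r i = z_edge r k \<longleftrightarrow> i = k" if "k \<in> {1..2 * r - 2}"
    using assms that r by (auto simp: z_edge_def doubleton_eq_iff split: if_splits)
qed

lemma edges_G_rd:
  "edges (G_rd r d) = a_edge ` {1..d} \<union> b_edge ` {1..d} \<union> z_edge r ` {1..2 * r - 2}"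
proof -
  have split: "{1..2 * r - 2} = {1} \<union> {2..2 * r - 3} \<union> {2 * r - 2}" using r by auto
  have ends: "z_edge r 1 = {X 1, Z 1}" "z_edge r (2 * r - 2) = {Z (2 * r - 3), X 2}"
  proof -
    have "2 * r - 2 \<noteq> 1" using r by arith
    then show "z_edge r (2 * r - 2) = {Z (2 * r - 3), X 2}" by (simp add: z_edge_def)
  qed (simp add: z_edge_def)
  have "z_edge r ` {1..2 * r - 2} =
      {{X 1, Z 1}} \<union> z_edge r ` {2..2 * r - 3} \<union> {{Z (2 * r - 3), X 2}}"
    unfolding split image_Un image_insert image_empty ends ..
  also have "z_edge r ` {2..2 * r - 3} = (\<lambda>i. {Z (i - 1), Z i}) ` {2..2 * r - 3}"
    using r by (intro image_cong refl) (auto simp: z_edge_def)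
  also have "\<dots> = {{Z (i - 1), Z i} |i. 2 \<le> i \<and> i \<le> 2 * r - 3}" by auto
  finally have z: "z_edge r ` {1..2 * r - 2} = {{X 1, Z 1}} \<union>
      {{Z (i - 1), Z i} |i. 2 \<le> i \<and> i \<le> 2 * r - 3} \<union> {{Z (2 * r - 3), X 2}}" .
  have "a_edge ` {1..d} = {{X 1, Y i} |i. 1 \<le> i \<and> i \<le> d}" "b_edge ` {1..d} = {{X 2, Y i} |i. 1 \<le> i \<and> i \<le> d}"
    by (auto simp: a_edge_def b_edge_def)
  then show ?thesis
    unfolding G_rd_def ugraph.simps z by (simp only: Un_assoc)
qed

lemma sum_edges_G_rd:
  "(\<Sum>x\<in>edges (G_rd r d). f x) =
     (\<Sum>i=1..d. f (a_edge i)) + (\<Sum>i=1..d. f (b_edge i)) + (\<Sum>i=1..2 * r - 2. f (z_edge r i))"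
  for f :: "vertex set \<Rightarrow> 'a::comm_monoid_add"
proof -
  have "(\<Sum>x\<in>edges (G_rd r d). f x) =
      sum f (a_edge ` {1..d}) + sum f (b_edge ` {1..d}) + sum f (z_edge r ` {1..2 * r - 2})"
    unfolding edges_G_rd
    by (subst sum.union_disjoint sum.union_disjoint; auto simp: edge_distinct z_edge_distinct)+
  also have "sum f (a_edge ` {1..d}) = (\<Sum>i=1..d. f (a_edge i))"
    by (subst sum.reindex) (auto simp: inj_on_def edge_distinct)
  also have "sum f (b_edge ` {1..d}) = (\<Sum>i=1..d. f (b_edge i))"
    by (subst sum.reindex) (auto simp: inj_on_def edge_distinct)
  also have "sum f (z_edge r ` {1..2 * r - 2}) = (\<Sum>i=1..2 * r - 2. f (z_edge r i))"
    by (subst sum.reindex) (auto simp: inj_on_def z_edge_distinct)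
  finally show ?thesis .
qed

lemma monom_degree_exps:
  assumes "Poly_Mapping.keys m \<subseteq> edges (G_rd r d)"
  shows "monom_degree m = sum (a_exp d m) {1..d} + sum (b_exp d m) {1..d} + sum (z_exp r m) {1..2 * r - 2}"
  unfolding monom_degree_superset[OF finite_simple_graph_edges(1)[OF finite_simple_graph_G_rd[OF r]] assms]
    sum_edges_G_rd
  by (intro arg_cong2[where f = "(+)"] sum.cong refl) (simp_all add: a_exp_def b_exp_def z_exp_def)

lemma lookup_vdeg_exps:
  assumes "Poly_Mapping.keys m \<subseteq> edges (G_rd r d)"
  shows "Poly_Mapping.lookup (vdeg m) =
    rd_degrees r (\<lambda>i. a_exp d m i + b_exp d m i) (sum (a_exp d m) {1..d}) (sum (b_exp d m) {1..d}) (z_exp r m)"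
proof
  fix v
  have lk: "Poly_Mapping.lookup (vdeg m) v =
      (\<Sum>i=1..d. if v \<in> a_edge i then a_exp d m i else 0) +
      (\<Sum>i=1..d. if v \<in> b_edge i then b_exp d m i else 0) +
      (\<Sum>i=1..2 * r - 2. if v \<in> z_edge r i then z_exp r m i else 0)"
    unfolding lookup_vdeg_graph[OF finite_simple_graph_G_rd[OF r] assms] sum_edges_G_rd
    by (intro arg_cong2[where f = "(+)"] sum.cong refl) (simp_all add: a_exp_def b_exp_def z_exp_def)
  show "Poly_Mapping.lookup (vdeg m) v =
    rd_degrees r (\<lambda>i. a_exp d m i + b_exp d m i) (sum (a_exp d m) {1..d}) (sum (b_exp d m) {1..d}) (z_exp r m) v"
  proof (cases v)
    case (X k)
    have "(\<Sum>i=1..2 * r - 2. if X k \<in> z_edge r i then z_exp r m i else 0) =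
        (\<Sum>i=1..2 * r - 2. if i = (if k = 1 then 1 else if k = 2 then 2 * r - 2 else 0) then z_exp r m i else 0)"
      using r by (intro sum.cong refl) (auto simp: z_edge_incidence)
    moreover have "1 \<le> 2 * r - 2" using r by arith
    ultimately show ?thesis
      unfolding lk unfolding X by (simp add: ab_edge_incidence rd_degrees_def)
  next
    case (Y k)
    have "(\<Sum>i=1..2 * r - 2. if Y k \<in> z_edge r i then z_exp r m i else 0) = 0"
      by (intro sum.neutral) (auto simp: z_edge_incidence)
    then show ?thesis
      unfolding lk unfolding Y by (simp add: ab_edge_incidence rd_degrees_def a_exp_def b_exp_def)
  next
    case (Z k)
    have "(\<Sum>i=1..2 * r - 2. if Z k \<in> z_edge r i then z_exp r m i else 0) =
        (\<Sum>i=1..2 * r - 2. (if i = k then if 1 \<le> k \<and> k \<le> 2 * r - 3 then z_exp r m k else 0 else 0) +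
          (if i = Suc k then if 1 \<le> k \<and> k \<le> 2 * r - 3 then z_exp r m (Suc k) else 0 else 0))"
      by (intro sum.cong refl) (auto simp: z_edge_incidence)
    also have "\<dots> = (if 1 \<le> k \<and> k \<le> 2 * r - 3 then z_exp r m k + z_exp r m (Suc k) else 0)"
      using r unfolding sum.distrib by auto
    finally show ?thesis
      unfolding lk unfolding Z by (simp add: ab_edge_incidence rd_degrees_def)
  qed
qed

lemma exps_inject:
  assumes "Poly_Mapping.keys m \<subseteq> edges (G_rd r d)" "Poly_Mapping.keys n \<subseteq> edges (G_rd r d)"
    and "a_exp d m = a_exp d n" "b_exp d m = b_exp d n" "z_exp r m = z_exp r n"
  shows "m = n"
proof (rule poly_mapping_eqI)
  fix x
  consider "x \<notin> edges (G_rd r d)" | i where "i \<in> {1..d}" "x = a_edge i" | i where "i \<in> {1..d}" "x = b_edge i"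
    | i where "i \<in> {1..2 * r - 2}" "x = z_edge r i"
    unfolding edges_G_rd by blast
  then show "Poly_Mapping.lookup m x = Poly_Mapping.lookup n x"
  proof cases
    case 1
    then have "x \<notin> Poly_Mapping.keys m" "x \<notin> Poly_Mapping.keys n" using assms by auto
    then show ?thesis by (simp add: in_keys_iff)
  next
    case (2 i)
    then show ?thesis using fun_cong[OF assms(3), of i] by (simp add: a_exp_def)
  next
    case (3 i)
    then show ?thesis using fun_cong[OF assms(4), of i] by (simp add: b_exp_def)
  next
    case (4 i)
    then show ?thesis using fun_cong[OF assms(5), of i] by (simp add: z_exp_def)
  qed
qed

lemma ex_monomial_with_exps:
  assumes "\<alpha> \<in> exponents {1..d}" "\<beta> \<in> exponents {1..d}" "e \<in> exponents {1..2 * r - 2}"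
  obtains m where "Poly_Mapping.keys m \<subseteq> edges (G_rd r d)" "a_exp d m = \<alpha>" "b_exp d m = \<beta>" "z_exp r m = e"
proof -
  define m where "m = (\<Sum>i=1..d. Poly_Mapping.single (a_edge i) (\<alpha> i)) +
    (\<Sum>i=1..d. Poly_Mapping.single (b_edge i) (\<beta> i)) + (\<Sum>i=1..2 * r - 2. Poly_Mapping.single (z_edge r i) (e i))"
  have lk: "Poly_Mapping.lookup m x = (\<Sum>i=1..d. if a_edge i = x then \<alpha> i else 0) +
    (\<Sum>i=1..d. if b_edge i = x then \<beta> i else 0) + (\<Sum>i=1..2 * r - 2. if z_edge r i = x then e i else 0)" for x
    by (simp add: m_def lookup_add lookup_sum lookup_single when_def)
  have "Poly_Mapping.keys m \<subseteq> edges (G_rd r d)"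
  proof
    fix x assume "x \<in> Poly_Mapping.keys m"
    then have nz: "Poly_Mapping.lookup m x \<noteq> 0" by (simp add: in_keys_iff)
    show "x \<in> edges (G_rd r d)"
    proof (rule ccontr)
      assume "x \<notin> edges (G_rd r d)"
      then have "\<forall>i\<in>{1..d}. a_edge i \<noteq> x" "\<forall>i\<in>{1..d}. b_edge i \<noteq> x" "\<forall>i\<in>{1..2 * r - 2}. z_edge r i \<noteq> x"
        unfolding edges_G_rd by blast+
      then have "Poly_Mapping.lookup m x = 0" unfolding lk by (simp cong: sum.cong)
      then show False using nz by simp
    qed
  qed
  moreover have z0: "Suc 0 \<le> i \<Longrightarrow> i \<le> 2 * r - 2 \<Longrightarrow> z_edge r i \<noteq> a_edge j \<and> z_edge r i \<noteq> b_edge j" for i j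
    using z_edge_distinct(3,4)[of i j] by simp
  have "a_exp d m = \<alpha>" "b_exp d m = \<beta>"
    using assms by (auto simp: fun_eq_iff a_exp_def b_exp_def lk z0 edge_distinct exponents_def)
  moreover have "z_exp r m i = e i" for i
  proof (cases "i \<in> {1..2 * r - 2}")
    case True
    have "(\<Sum>j=1..2 * r - 2. if z_edge r j = z_edge r i then e j else 0) = (\<Sum>j=1..2 * r - 2. if j = i then e j else 0)"
      using z_edge_distinct(5)[OF _ True] by (intro sum.cong refl) auto
    then show ?thesis using True by (simp add: z_exp_def lk z_edge_distinct)
  next
    case False
    then show ?thesis using assms by (auto simp: z_exp_def exponents_def)
  qed
  then have "z_exp r m = e" by blast
  ultimately show thesis by (rule that)
qed

end

section \<open>Normal forms of vertex monomials\<close>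

text \<open>
  At each inner vertex of a path, the labels of the two edges that meet there change by opposite amounts if their sum is fixed.
\<close>

lemma alternating_difference:
  fixes e e' :: "nat \<Rightarrow> nat"
  assumes "\<And>j. 1 \<le> j \<Longrightarrow> j < M \<Longrightarrow> e j + e (Suc j) = e' j + e' (Suc j)" and "1 \<le> i" "i \<le> M"
  shows "int (e i) - int (e' i) = (if odd i then 1 else - 1) * (int (e 1) - int (e' 1))"
  using assms(2,3)
proof (induction i rule: dec_induct)
  case (step j)
  then have "int (e j + e (Suc j)) = int (e' j + e' (Suc j))" using assms(1)[of j] by simp
  then show ?case using step by (simp split: if_splits)
qed simp

text \<open>
  Serves to choose which of the \<open>c i\<close> edges at \<open>y\<^sub>i\<close> end at \<open>x\<^sub>2\<close>, when an edge monomial is built from the data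
  \<open>c\<close> and \<open>q\<close>.
\<close>

lemma split_exponents:
  assumes "c \<in> exponents C" "finite C" "q \<le> sum c C"
  shows "\<exists>\<alpha>\<in>exponents C. \<exists>\<beta>\<in>exponents C. (\<forall>x. \<alpha> x + \<beta> x = c x) \<and> sum \<beta> C = q"
  using assms(3)
proof (induction q)
  case 0
  show ?case
    using assms(1) by (intro bexI[of _ c] bexI[of _ "\<lambda>_. 0"]) (auto simp: exponents_def)
next
  case (Suc q)
  then obtain \<alpha> \<beta> where ab: "\<alpha> \<in> exponents C" "\<beta> \<in> exponents C" "\<forall>x. \<alpha> x + \<beta> x = c x" "sum \<beta> C = q"
    by auto
  have "sum c C = sum \<alpha> C + sum \<beta> C" using ab(3) by (simp flip: sum.distrib)
  then have "sum \<alpha> C \<noteq> 0" using Suc.prems ab(4) by simp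
  then obtain x where x: "x \<in> C" "\<alpha> x > 0" by (metis gr0I sum.neutral)
  have "sum (\<beta>(x := Suc (\<beta> x))) C = Suc q"
    using x(1) ab(4) by (simp add: sum.remove[OF assms(2) x(1)])
  moreover have "\<forall>y. (\<alpha>(x := \<alpha> x - 1)) y + (\<beta>(x := Suc (\<beta> x))) y = c y"
    using ab(3) x(2) by (auto simp flip: ab(3)[rule_format])
  moreover have "\<alpha>(x := \<alpha> x - 1) \<in> exponents C" "\<beta>(x := Suc (\<beta> x)) \<in> exponents C"
    using ab(1,2) x(1) by (auto simp: exponents_def)
  ultimately show ?case by blast
qed

lemma sum_parity:
  fixes f :: "nat \<Rightarrow> nat"
  shows "sum f {1..2 * r - 2} = sum f (odd_places r) + (\<Sum>i\<in>{i \<in> {1..2 * r - 2}. even i}. f i)"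
proof -
  have "{1..2 * r - 2} = odd_places r \<union> {i \<in> {1..2 * r - 2}. even i}" by (auto simp: odd_places_def)
  then show ?thesis
    by (metis (no_types, lifting) sum.union_disjoint finite_Un finite_atLeastAtMost disjoint_iff mem_Collect_eq odd_places_def)
qed

lemma card_even_places: "card {i \<in> {1..2 * r - 2}. even i} = r - 1"
  using sum_parity[of "\<lambda>_. 1" r] by (simp add: card_odd_places)

context
  fixes r d :: nat
  assumes r: "r \<ge> 3"
begin

text \<open>
  The move along the even cycles is applied as often as \<open>q\<close> and the odd positions of \<open>e\<close> permit. It preserves the total weight, as
  there are as many odd positions as even ones.
\<close>

lemma rd_degrees_normalize:
  assumes e: "e \<in> exponents {1..2 * r - 2}" and q: "q \<le> t"
  obtains q' e' where "q' \<le> t" "e' \<in> exponents {1..2 * r - 2}" "q' = 0 \<or> (\<exists>i\<in>odd_places r. e' i = 0)"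
    "sum e' {1..2 * r - 2} = sum e {1..2 * r - 2}"
    "rd_degrees r c (t - q') q' e' = rd_degrees r c (t - q) q e"
proof -
  have fin: "finite (odd_places r)" by (simp add: odd_places_def)
  define s where "s = Min (insert q (e ` odd_places r))"
  have s_le: "s \<le> q" "\<And>i. i \<in> odd_places r \<Longrightarrow> s \<le> e i"
    unfolding s_def using fin by auto
  have "s \<in> insert q (e ` odd_places r)" unfolding s_def by (rule Min_in) (use fin in auto)
  then have s_attained: "s = q \<or> (\<exists>i\<in>odd_places r. e i = s)" by auto
  define e' where "e' i = (if i \<in> odd_places r then e i - s else if i \<in> {1..2 * r - 2} then e i + s else 0)" for i
  have "sum e' (odd_places r) + s * (r - 1) = sum e (odd_places r)"
  proof -
    have "sum e' (odd_places r) + (\<Sum>i\<in>odd_places r. s) = (\<Sum>i\<in>odd_places r. e' i + s)" by (rule sum.distrib[symmetric])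
    also have "\<dots> = sum e (odd_places r)" using s_le by (intro sum.cong refl) (simp add: e'_def)
    finally show ?thesis by (simp add: card_odd_places mult.commute)
  qed
  moreover have "sum e' {i \<in> {1..2 * r - 2}. even i} = sum e {i \<in> {1..2 * r - 2}. even i} + s * (r - 1)"
  proof -
    have "sum e' {i \<in> {1..2 * r - 2}. even i} = (\<Sum>i\<in>{i \<in> {1..2 * r - 2}. even i}. e i + s)"
      by (intro sum.cong refl) (auto simp: e'_def odd_places_def)
    also have "\<dots> = sum e {i \<in> {1..2 * r - 2}. even i} + card {i \<in> {1..2 * r - 2}. even i} * s" by (simp add: sum.distrib)
    finally show ?thesis unfolding card_even_places by (simp only: mult.commute[of s])
  qed
  ultimately have sum: "sum e' {1..2 * r - 2} = sum e {1..2 * r - 2}" unfolding sum_parity by linarith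
  have "1 \<in> odd_places r" "2 * r - 2 \<notin> odd_places r" "2 * r - 2 \<in> {1..2 * r - 2}"
    using r by (auto simp: odd_places_def)
  then have ends: "s \<le> e 1" "e' 1 = e 1 - s" "e' (2 * r - 2) = e (2 * r - 2) + s"
    using s_le by (auto simp: e'_def)
  have "e' j + e' (Suc j) = e j + e (Suc j)" if "1 \<le> j" "j \<le> 2 * r - 3" for j
  proof (cases "odd j")
    case True
    then have "j \<in> odd_places r" "Suc j \<notin> odd_places r" "Suc j \<in> {1..2 * r - 2}"
      using that r by (auto simp: odd_places_def)
    then show ?thesis using s_le(2)[of j] by (simp add: e'_def)
  next
    case False
    have "Suc j \<noteq> 2 * r - 2" using False that r by presburger
    then have "j \<notin> odd_places r" "Suc j \<in> odd_places r" "j \<in> {1..2 * r - 2}"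
      using False that r by (auto simp: odd_places_def)
    then show ?thesis using s_le(2)[of "Suc j"] by (simp add: e'_def)
  qed
  then have "rd_degrees r c (t - (q - s)) (q - s) e' = rd_degrees r c (t - q) q e"
    using s_le(1) q ends by (auto simp: rd_degrees_def fun_eq_iff split: vertex.split)
  moreover have "q - s = 0 \<or> (\<exists>i\<in>odd_places r. e' i = 0)"
    using s_attained by (auto simp: e'_def)
  moreover have "e' \<in> exponents {1..2 * r - 2}" by (auto simp: exponents_def e'_def odd_places_def)
  moreover have "q - s \<le> t" using q by simp
  ultimately show thesis using sum that by blast
qed

text \<open>
  By \<open>alternating_difference\<close>, triples with the same vertex exponents differ by an integer \<open>t\<close> added to \<open>q\<close> and to all odd positions
  of \<open>e\<close>. If \<open>t \<noteq> 0\<close>, then the larger triple has neither \<open>q = 0\<close> nor a zero at an odd position.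
\<close>

lemma inj_on_normal_forms:
  "inj_on (\<lambda>(c, q, e). rd_degrees r c (sum c {1..d} - q) q e) (normal_forms {1..d} {1..2 * r - 2} (odd_places r))"
proof (rule inj_onI)
  fix p p'
  assume p: "p \<in> normal_forms {1..d} {1..2 * r - 2} (odd_places r)"
      "p' \<in> normal_forms {1..d} {1..2 * r - 2} (odd_places r)"
    and peq: "(\<lambda>(c, q, e). rd_degrees r c (sum c {1..d} - q) q e) p =
      (\<lambda>(c, q, e). rd_degrees r c (sum c {1..d} - q) q e) p'"
  obtain c q e c' q' e' where pp: "p = (c, q, e)" "p' = (c', q', e')" by (metis prod_cases3)
  then have nf: "(c, q, e) \<in> normal_forms {1..d} {1..2 * r - 2} (odd_places r)"
      "(c', q', e') \<in> normal_forms {1..d} {1..2 * r - 2} (odd_places r)"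
    and eq: "rd_degrees r c (sum c {1..d} - q) q e = rd_degrees r c' (sum c' {1..d} - q') q' e'"
    using p peq by simp_all
  have c: "c = c'"
  proof
    show "c i = c' i" for i using fun_cong[OF eq, of "Y i"] by (simp add: rd_degrees_def)
  qed
  have "e j + e (Suc j) = e' j + e' (Suc j)" if "1 \<le> j" "j < 2 * r - 2" for j
  proof -
    have "j \<le> 2 * r - 3" using that by arith
    then show ?thesis using that fun_cong[OF eq, of "Z j"] by (simp add: rd_degrees_def)
  qed
  then have alt: "int (e i) - int (e' i) = (if odd i then 1 else - 1) * (int (e 1) - int (e' 1))"
    if "1 \<le> i" "i \<le> 2 * r - 2" for i
    using that by (rule alternating_difference)
  have q: "q \<le> sum c {1..d}" "q' \<le> sum c {1..d}" using nf by (auto simp: normal_forms_def c)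
  have "sum c {1..d} - q + e 1 = sum c {1..d} - q' + e' 1"
    using fun_cong[OF eq, of "X 1"] by (simp add: rd_degrees_def c)
  then have t: "int (e 1) - int (e' 1) = int q - int q'" using q by linarith
  have odd_alt: "int (e i) - int (e' i) = int q - int q'" if "i \<in> odd_places r" for i
    using alt[of i] that t by (simp add: odd_places_def)
  have nz: "q = 0 \<or> (\<exists>i\<in>odd_places r. e i = 0)" "q' = 0 \<or> (\<exists>i\<in>odd_places r. e' i = 0)"
    using nf by (auto simp: normal_forms_def)
  have "q \<le> q'"
  proof (rule ccontr)
    assume "\<not> q \<le> q'"
    then obtain i where "i \<in> odd_places r" "e i = 0" using nz(1) by auto
    then show False using odd_alt[of i] \<open>\<not> q \<le> q'\<close> by linarith
  qed
  moreover have "q' \<le> q"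
  proof (rule ccontr)
    assume "\<not> q' \<le> q"
    then obtain i where "i \<in> odd_places r" "e' i = 0" using nz(2) by auto
    then show False using odd_alt[of i] \<open>\<not> q' \<le> q\<close> by linarith
  qed
  ultimately have qq: "q = q'" by simp
  have "e i = e' i" for i
  proof (cases "i \<in> {1..2 * r - 2}")
    case True
    then show ?thesis using alt[of i] t qq by simp
  next
    case False
    then show ?thesis using nf by (auto simp: normal_forms_def exponents_def)
  qed
  then show "p = p'" using c qq pp by auto
qed

lemma lookup_edge_degrees:
  "Poly_Mapping.lookup ` edge_degrees (G_rd r d) n =
     (\<lambda>(c, q, e). rd_degrees r c (sum c {1..d} - q) q e) `
       {p \<in> normal_forms {1..d} {1..2 * r - 2} (odd_places r). (\<lambda>(c, q, e). sum c {1..d} + sum e {1..2 * r - 2}) p = n}"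
  (is "?L = ?R")
proof
  show "?L \<subseteq> ?R"
  proof
    fix v assume "v \<in> ?L"
    then obtain m where m: "Poly_Mapping.keys m \<subseteq> edges (G_rd r d)" "monom_degree m = n"
      "v = Poly_Mapping.lookup (vdeg m)"
      by (auto simp: edge_degrees_def)
    define c where "c = (\<lambda>i. a_exp d m i + b_exp d m i)"
    define q where "q = sum (b_exp d m) {1..d}"
    have c_sum: "sum c {1..d} = sum (a_exp d m) {1..d} + q" by (simp add: c_def q_def sum.distrib)
    have c: "c \<in> exponents {1..d}" by (auto simp: c_def exponents_def a_exp_def b_exp_def)
    have v: "v = rd_degrees r c (sum c {1..d} - q) q (z_exp r m)"
      unfolding m(3) lookup_vdeg_exps[OF r m(1)] c_sum by (simp add: c_def q_def)
    obtain q' e' where qe: "q' \<le> sum c {1..d}" "e' \<in> exponents {1..2 * r - 2}"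
      "q' = 0 \<or> (\<exists>i\<in>odd_places r. e' i = 0)" "sum e' {1..2 * r - 2} = sum (z_exp r m) {1..2 * r - 2}"
      "rd_degrees r c (sum c {1..d} - q') q' e' = v"
      unfolding v by (rule rd_degrees_normalize[OF exps_mem(3), of q "sum c {1..d}" m c]) (use c_sum in simp)
    moreover have "sum c {1..d} + sum e' {1..2 * r - 2} = n"
      using m(2) monom_degree_exps[OF r m(1)] qe(4) c_sum by (simp add: q_def)
    ultimately show "v \<in> ?R"
      using c by (intro image_eqI[of _ _ "(c, q', e')"]) (auto simp: normal_forms_def)
  qed
  show "?R \<subseteq> ?L"
  proof (rule image_subsetI, clarify)
    fix c q e assume nf: "(c, q, e) \<in> normal_forms {1..d} {1..2 * r - 2} (odd_places r)"
    then have c: "c \<in> exponents {1..d}" "q \<le> sum c {1..d}" "e \<in> exponents {1..2 * r - 2}"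
      by (auto simp: normal_forms_def)
    obtain \<alpha> \<beta> where ab: "\<alpha> \<in> exponents {1..d}" "\<beta> \<in> exponents {1..d}" "\<forall>x. \<alpha> x + \<beta> x = c x" "sum \<beta> {1..d} = q"
      using split_exponents[OF c(1) _ c(2)] by auto
    obtain m where m: "Poly_Mapping.keys m \<subseteq> edges (G_rd r d)" "a_exp d m = \<alpha>" "b_exp d m = \<beta>" "z_exp r m = e"
      using ex_monomial_with_exps[OF r ab(1,2) c(3)] by blast
    have c_eq: "(\<lambda>i. \<alpha> i + \<beta> i) = c" using ab(3) by auto
    have c_sum: "sum c {1..d} = sum \<alpha> {1..d} + q"
      unfolding c_eq[symmetric] ab(4)[symmetric] by (rule sum.distrib)
    have "Poly_Mapping.lookup (vdeg m) = rd_degrees r c (sum c {1..d} - q) q e"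
      unfolding lookup_vdeg_exps[OF r m(1)] m(2,3,4) ab(4) c_sum c_eq by simp
    moreover have "monom_degree m = sum c {1..d} + sum e {1..2 * r - 2}"
      unfolding monom_degree_exps[OF r m(1)] m(2,3,4) ab(4) c_sum ..
    ultimately show "rd_degrees r c (sum c {1..d} - q) q e \<in>
        Poly_Mapping.lookup ` edge_degrees (G_rd r d) (sum c {1..d} + sum e {1..2 * r - 2})"
      using m(1) unfolding edge_degrees_def by (metis (mono_tags, lifting) image_eqI mem_Collect_eq)
  qed
qed

lemma card_edge_degrees_G_rd:
  "card (edge_degrees (G_rd r d) n) =
     card {p \<in> normal_forms {1..d} {1..2 * r - 2} (odd_places r). (\<lambda>(c, q, e). sum c {1..d} + sum e {1..2 * r - 2}) p = n}"
proof -
  have "card (edge_degrees (G_rd r d) n) = card (Poly_Mapping.lookup ` edge_degrees (G_rd r d) n)"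
    by (rule card_image[symmetric]) (auto simp: inj_on_def intro!: poly_mapping_eqI)
  also have "\<dots> = card {p \<in> normal_forms {1..d} {1..2 * r - 2} (odd_places r).
      (\<lambda>(c, q, e). sum c {1..d} + sum e {1..2 * r - 2}) p = n}"
    unfolding lookup_edge_degrees
    by (rule card_image) (rule inj_on_subset[OF inj_on_normal_forms], blast)
  finally show ?thesis .
qed

text \<open>
  One side of the bipartition consists of \<open>x\<^sub>1\<close>, \<open>x\<^sub>2\<close> and the \<open>z\<^sub>j\<close> with \<open>j\<close> even.
\<close>

lemma edge_degrees_growth_G_rd:
  "card (\<Union>i\<le>N. edge_degrees (G_rd r d) i) \<le> (N + 1) ^ (d + 2 * r - 2)"
proof -
  let ?S = "{X 1, X 2} \<union> Z ` {i \<in> {1..2 * r - 3}. even i}"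
  let ?T = "Y ` {1..d} \<union> Z ` {i \<in> {1..2 * r - 3}. odd i}"
  have V: "verts (G_rd r d) = ?S \<union> ?T" by (auto simp: G_rd_def)
  have disj: "?S \<inter> ?T = {}" by auto
  have "card (e \<inter> ?S) = 1 \<and> card (e \<inter> ?T) = 1" if e: "e \<in> edges (G_rd r d)" for e
  proof -
    have "\<exists>x y. e = {x, y} \<and> x \<in> ?S \<and> y \<in> ?T"
    proof -
      consider i where "i \<in> {1..d}" "e = a_edge i" | i where "i \<in> {1..d}" "e = b_edge i"
        | i where "i \<in> {1..2 * r - 2}" "e = z_edge r i"
        using e unfolding edges_G_rd[OF r] by blast
      then show ?thesis
      proof cases
        case (1 i)
        then show ?thesis by (intro exI[of _ "X 1"] exI[of _ "Y i"]) (simp add: a_edge_def)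
      next
        case (2 i)
        then show ?thesis by (intro exI[of _ "X 2"] exI[of _ "Y i"]) (simp add: b_edge_def)
      next
        case (3 i)
        consider "i = 1" | "i = 2 * r - 2" | "i \<noteq> 1" "i \<noteq> 2 * r - 2" "even i" | "i \<noteq> 1" "i \<noteq> 2 * r - 2" "odd i" by blast
        then show ?thesis
        proof cases
          case 1
          then show ?thesis using r 3 by (intro exI[of _ "X 1"] exI[of _ "Z 1"]) (auto simp: z_edge_def)
        next
          case 2
          have "2 * r - 2 \<noteq> 1" "odd (2 * r - 3)" using r by presburger+
          then show ?thesis using r 2 3 by (intro exI[of _ "X 2"] exI[of _ "Z (2 * r - 3)"]) (auto simp: z_edge_def)
        next
          case three: 3
          then show ?thesis using r 3 by (intro exI[of _ "Z i"] exI[of _ "Z (i - 1)"]) (auto simp: z_edge_def)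
        next
          case 4
          then show ?thesis using r 3 by (intro exI[of _ "Z (i - 1)"] exI[of _ "Z i"]) (auto simp: z_edge_def)
        qed
      qed
    qed
    then obtain x y where "e = {x, y}" "x \<in> ?S" "y \<in> ?T" by blast
    then have "e \<inter> ?S = {x}" "e \<inter> ?T = {y}" using disj by blast+
    then show ?thesis by simp
  qed
  then have "card (\<Union>i\<le>N. edge_degrees (G_rd r d) i) \<le> (N + 1) ^ (card (verts (G_rd r d)) - 1)"
    by (intro edge_degrees_growth_bipartite[OF finite_simple_graph_G_rd[OF r] V disj, of "X 1"]) auto
  also have "card (verts (G_rd r d)) = 2 + d + (2 * r - 3)"
    unfolding G_rd_def ugraph.simps
    by (subst card_Un_disjoint, auto simp: card_Un_disjoint card_image inj_on_def card_insert_if image_iff)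
  also have "2 + d + (2 * r - 3) - 1 = d + 2 * r - 2" using r by arith
  finally show ?thesis .
qed

end

section \<open>A maximal chain of faces\<close>

text \<open>
  The order on the vertices is arbitrary; it only serves to make the polynomial ring in the vertices an integral domain.
\<close>

instance vertex :: countable by countable_datatype

instantiation vertex :: linorder
begin

definition "v \<le> w \<longleftrightarrow> to_nat v \<le> to_nat w" for v w :: vertex

definition "v < w \<longleftrightarrow> to_nat v < to_nat w" for v w :: vertex

instance
  by standard (auto simp: less_eq_vertex_def less_vertex_def)

end

text \<open>
  Numbers the edges that remain after removing \<open>y\<^sub>1, \<dots>, y\<^sub>d\<^sub>-\<^sub>1\<close>, \<open>e\<^sub>1\<close> and \<open>e\<^sub>2\<close>: the positions of \<open>e\<^sub>1\<close> and \<open>e\<^sub>2\<close> are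
  reused for \<open>a\<^sub>d\<close> and \<open>b\<^sub>d\<close>.
\<close>

definition path_edge :: "nat \<Rightarrow> nat \<Rightarrow> nat \<Rightarrow> vertex set" where
  "path_edge r d k = (if k = 1 then a_edge d else if k = 2 then b_edge d else z_edge r k)"

definition face_chain :: "nat \<Rightarrow> nat \<Rightarrow> nat \<Rightarrow> vertex set set" where
  "face_chain r d i =
     (if i < d then {e \<in> edges (G_rd r d). e \<inter> Y ` {1..i} = {}} else path_edge r d ` {Suc (i - d)..2 * r - 2})"

context
  fixes r d :: nat
  assumes r: "r \<ge> 3" and d: "d \<ge> 1"
begin

lemma path_edge_mem: "k \<in> {1..2 * r - 2} \<Longrightarrow> path_edge r d k \<in> edges (G_rd r d)"
  using d by (auto simp: path_edge_def edges_G_rd[OF r])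

lemma path_edge_avoids: "k \<in> {1..2 * r - 2} \<Longrightarrow> path_edge r d k \<inter> Y ` {1..d - 1} = {}"
  using z_edge_incidence(2)[OF r] d by (auto simp: path_edge_def ab_edge_incidence)

lemma inj_on_path_edge: "inj_on (path_edge r d) {1..2 * r - 2}"
  using z_edge_distinct[OF r] by (auto simp: inj_on_def path_edge_def edge_distinct)

lemma z_edge_notin_path:
  assumes "i \<in> {1, 2}"
  shows "z_edge r i \<notin> path_edge r d ` {1..2 * r - 2}"
proof
  have i: "i \<in> {1..2 * r - 2}" using assms r by auto
  assume "z_edge r i \<in> path_edge r d ` {1..2 * r - 2}"
  then obtain k where k: "k \<in> {1..2 * r - 2}" "z_edge r i = path_edge r d k" by blast
  then have "k \<noteq> 1" "k \<noteq> 2"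
    using z_edge_distinct(3,4)[OF r i, of d] unfolding path_edge_def by metis+
  then have "i = k" using k z_edge_distinct(5)[OF r i k(1)] by (simp add: path_edge_def)
  then show False using assms \<open>k \<noteq> 1\<close> \<open>k \<noteq> 2\<close> by auto
qed

text \<open>
  A monomial \<open>m\<close> supported on the path is determined among all edge monomials by its vertex monomial, so every subset of the
  path is a face. Indeed, let \<open>n\<close> have the same vertex monomial. As \<open>y\<^sub>1, \<dots>, y\<^sub>d\<^sub>-\<^sub>1\<close> do not occur in it, \<open>n\<close> is supported on a
  single cycle, on which it differs from \<open>m\<close> by an alternating multiple of some \<open>t\<close>. Since \<open>m\<close> vanishes at \<open>e\<^sub>1\<close> and
  \<open>e\<^sub>2\<close>, the exponents of \<open>n\<close> there are \<open>t\<close> and \<open>-t\<close>; so \<open>t = 0\<close>.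
\<close>

lemma is_face_path:
  assumes F: "F \<subseteq> path_edge r d ` {1..2 * r - 2}"
  shows "is_face (G_rd r d) F"
  unfolding is_face_def
proof (intro conjI allI impI)
  show "F \<subseteq> edges (G_rd r d)" using F path_edge_mem by blast
  fix m n
  assume m: "Poly_Mapping.keys m \<subseteq> edges (G_rd r d)" and n: "Poly_Mapping.keys n \<subseteq> edges (G_rd r d)"
    and eq: "vdeg m = vdeg n" and mF: "Poly_Mapping.keys m \<subseteq> F"
  let ?A = "{e \<in> edges (G_rd r d). e \<inter> Y ` {1..d - 1} = {}}"
  have mA: "Poly_Mapping.keys m \<subseteq> ?A" using mF F m path_edge_avoids by blast
  have nA: "Poly_Mapping.keys n \<subseteq> ?A"
    by (rule is_faceD[OF is_face_avoiding[OF finite_simple_graph_G_rd[OF r]] m n eq mA])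
  have ab0: "a_exp d l i = 0" "b_exp d l i = 0" if l: "Poly_Mapping.keys l \<subseteq> ?A" and "i \<noteq> d" for l i
  proof -
    have "a_edge i \<notin> Poly_Mapping.keys l \<and> b_edge i \<notin> Poly_Mapping.keys l" if "i \<in> {1..d}"
    proof -
      have "Y i \<in> Y ` {1..d - 1}" using that \<open>i \<noteq> d\<close> by (intro imageI) auto
      then show ?thesis using l by (auto simp: a_edge_def b_edge_def)
    qed
    then show "a_exp d l i = 0" "b_exp d l i = 0" by (auto simp: a_exp_def b_exp_def in_keys_iff)
  qed
  have sum_a: "sum (a_exp d l) {1..d} = a_exp d l d" if "Poly_Mapping.keys l \<subseteq> ?A" for l
    using d ab0[OF that] by (subst sum.remove[of _ d]) auto
  have z0: "z_exp r m i = 0" if "i \<in> {1, 2}" for i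
    using z_edge_notin_path[OF that] mF F by (auto simp: z_exp_def in_keys_iff)
  have rd: "rd_degrees r (\<lambda>i. a_exp d m i + b_exp d m i) (sum (a_exp d m) {1..d}) (sum (b_exp d m) {1..d}) (z_exp r m)
      = rd_degrees r (\<lambda>i. a_exp d n i + b_exp d n i) (sum (a_exp d n) {1..d}) (sum (b_exp d n) {1..d}) (z_exp r n)"
    unfolding lookup_vdeg_exps[OF r m, symmetric] lookup_vdeg_exps[OF r n, symmetric] eq ..
  have "z_exp r m j + z_exp r m (Suc j) = z_exp r n j + z_exp r n (Suc j)" if "1 \<le> j" "j < 2 * r - 2" for j
  proof -
    have "j \<le> 2 * r - 3" using that by arith
    then show ?thesis using that fun_cong[OF rd, of "Z j"] by (simp add: rd_degrees_def)
  qed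
  then have alt: "int (z_exp r m i) - int (z_exp r n i) =
      (if odd i then 1 else - 1) * (int (z_exp r m 1) - int (z_exp r n 1))" if "1 \<le> i" "i \<le> 2 * r - 2" for i
    using that by (rule alternating_difference)
  have "z_exp r n 2 + z_exp r n 1 = 0" using alt[of 2] r z0[of 1] z0[of 2] by simp
  then have n1: "z_exp r n 1 = 0" by simp
  have z: "z_exp r m = z_exp r n"
  proof
    show "z_exp r m i = z_exp r n i" for i
      using alt[of i] n1 z0[of 1] by (cases "i \<in> {1..2 * r - 2}") (auto simp: z_exp_def)
  qed
  have ad: "a_exp d m d = a_exp d n d"
    using fun_cong[OF rd, of "X 1"] n1 z0[of 1] by (simp add: rd_degrees_def sum_a[OF mA, simplified] sum_a[OF nA, simplified])
  have bd: "b_exp d m d = b_exp d n d"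
    using fun_cong[OF rd, of "Y d"] ad by (simp add: rd_degrees_def)
  have "a_exp d m i = a_exp d n i" "b_exp d m i = b_exp d n i" for i
    using ad bd ab0[OF mA, of i] ab0[OF nA, of i] by (cases "i = d"; simp)+
  then have "m = n" using z by (intro exps_inject[OF r m n]) auto
  then show "Poly_Mapping.keys n \<subseteq> F" using mF by simp
qed

lemma is_face_face_chain: "is_face (G_rd r d) (face_chain r d i)"
proof (cases "i < d")
  case True
  then show ?thesis
    using is_face_avoiding[OF finite_simple_graph_G_rd[OF r]] by (simp add: face_chain_def)
next
  case False
  then show ?thesis by (simp add: face_chain_def) (intro is_face_path image_mono, auto)
qed

lemma face_chain_strict:
  assumes "i < d + 2 * r - 2"
  shows "face_chain r d (Suc i) \<subset> face_chain r d i"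
proof -
  consider "Suc i < d" | "Suc i = d" | "d \<le> i" by linarith
  then show ?thesis
  proof cases
    case 1
    have "a_edge (Suc i) \<in> face_chain r d i" "a_edge (Suc i) \<notin> face_chain r d (Suc i)"
      using 1 by (auto simp: face_chain_def edges_G_rd[OF r] a_edge_def)
    moreover have "face_chain r d (Suc i) \<subseteq> face_chain r d i"
      using 1 by (auto simp: face_chain_def)
    ultimately show ?thesis by blast
  next
    case 2
    have chain: "face_chain r d i = {e \<in> edges (G_rd r d). e \<inter> Y ` {1..d - 1} = {}}"
      "face_chain r d (Suc i) = path_edge r d ` {1..2 * r - 2}"
      using 2 by (auto simp: face_chain_def)
    have 1: "1 \<in> {1..2 * r - 2}" using r by auto
    then have "z_edge r 1 \<in> face_chain r d i"
      using z_edge_incidence(2)[OF r 1] unfolding chain edges_G_rd[OF r] by auto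
    moreover have "z_edge r 1 \<notin> face_chain r d (Suc i)"
      unfolding chain by (rule z_edge_notin_path) simp
    moreover have "face_chain r d (Suc i) \<subseteq> face_chain r d i"
      unfolding chain using path_edge_mem path_edge_avoids by blast
    ultimately show ?thesis by blast
  next
    case 3
    let ?k = "Suc (i - d)"
    have k: "?k \<in> {1..2 * r - 2}" using 3 assms by auto
    have chain: "face_chain r d i = path_edge r d ` {?k..2 * r - 2}"
      "face_chain r d (Suc i) = path_edge r d ` {Suc ?k..2 * r - 2}"
      using 3 by (simp_all add: face_chain_def Suc_diff_le)
    have "path_edge r d ?k \<notin> path_edge r d ` {Suc ?k..2 * r - 2}"
      using inj_on_path_edge k by (subst inj_on_image_mem_iff[of _ "{1..2 * r - 2}"]) auto
    then show ?thesis unfolding chain using k by auto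
  qed
qed

lemma krull_dim_G_rd:
  "krull_dim (mpoly_ring (edges (G_rd r d)) Quot (toric_ideal (G_rd r d) :: (vertex set, 'k::field) mpoly set))
     = enat (d + 2 * r - 2)"
  by (rule krull_dim_toric[where F = "face_chain r d", OF finite_simple_graph_G_rd[OF r] refl edge_degrees_growth_G_rd[OF r]
        is_face_face_chain face_chain_strict])

lemma hilbert_series_G_rd:
  "hilbert_series (edges (G_rd r d)) (toric_ideal (G_rd r d) :: (vertex set, 'k::field) mpoly set) *
     (1 - fps_X) ^ (d + 2 * r - 2) = 1 + (\<Sum>i=1..r-1. of_nat d * fps_X ^ i)"
proof -
  let ?H = "hilbert_series (edges (G_rd r d)) (toric_ideal (G_rd r d) :: (vertex set, 'k) mpoly set)"
  have H: "?H = weight_series (normal_forms {1..d} {1..2 * r - 2} (odd_places r))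
      (\<lambda>(c, q, e). sum c {1..d} + sum e {1..2 * r - 2})"
    unfolding hilbert_series_def weight_series_def dim_toric_quotient[OF finite_simple_graph_G_rd[OF r]]
      card_edge_degrees_G_rd[OF r] ..
  have "d + 2 * r - 2 = card {1..d} + card {1..2 * r - 2}" using r by simp
  then have "?H * (1 - fps_X) ^ (d + 2 * r - 2) = 1 + of_nat (card {1..d}) * fps_X * (\<Sum>i<card (odd_places r). fps_X ^ i)"
    unfolding H by (simp only:) (rule weight_series_normal_forms, auto simp: odd_places_def)
  also have "\<dots> = 1 + (\<Sum>i<r - 1. of_nat d * fps_X ^ Suc i)"
    by (simp add: card_odd_places sum_distrib_left mult_ac)
  also have "(\<Sum>i<r - 1. of_nat d * fps_X ^ Suc i) = (\<Sum>i=1..r-1. of_nat d * fps_X ^ i :: rat fps)"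
    by (rule sum.reindex_bij_witness[of _ "\<lambda>i. i - 1" Suc]) auto
  finally show ?thesis .
qed

end

section \<open>The Hilbert series and the h-vector\<close>

lemma strip_while_replicate: "\<not> P x \<Longrightarrow> strip_while P (replicate n x) = replicate n x"
  by (simp add: strip_while_def)

theorem theorem4p3:
  fixes r d :: nat
    and I :: "(vertex set, 'k::field) mpoly set"
  assumes "r \<ge> 3" and "d \<ge> 2"
    and "I = toric_ideal (G_rd r d)"
  shows "hilbert_series (edges (G_rd r d)) I =
           (1 + (\<Sum>i=1..r-1. of_nat d * fps_X ^ i)) / (1 - fps_X) ^ (d + 2 * r - 2)
         \<and> is_h_vector (edges (G_rd r d)) I (1 # replicate (r - 1) (int d))"
proof
  let ?H = "hilbert_series (edges (G_rd r d)) I" and ?D = "d + 2 * r - 2"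
  let ?N = "1 + (\<Sum>i=1..r-1. of_nat d * fps_X ^ i) :: rat fps"
  have d: "d \<ge> 1" using assms(2) by simp
  have "fps_nth (1 - fps_X :: rat fps) 0 \<noteq> 0" by simp
  then have "(1 - fps_X :: rat fps) ^ ?D \<noteq> 0" by (metis fps_zero_nth power_not_zero)
  moreover have "?H * (1 - fps_X) ^ ?D = ?N"
    unfolding assms(3) by (rule hilbert_series_G_rd[OF assms(1) d])
  ultimately show H: "?H = ?N / (1 - fps_X) ^ ?D"
    by (metis nonzero_mult_div_cancel_right)
  let ?h = "1 # replicate (r - 1) (int d)"
  have "fps_of_poly (map_poly of_int (Poly ?h)) = ?N"
  proof (rule fps_ext)
    fix n
    have "fps_nth (of_nat d * fps_X ^ i) n = (if n = i then of_nat d else 0 :: rat)" for i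
      by (simp add: fps_of_nat[symmetric])
    then have N: "fps_nth ?N n = (if n = 0 then 1 else if n \<le> r - 1 then of_nat d else 0)"
      by (auto simp: fps_sum_nth)
    have h: "coeff (Poly ?h) n = (if n = 0 then 1 else if n \<le> r - 1 then int d else 0)"
      unfolding coeff_Poly_eq by (auto simp: nth_default_def nth_Cons split: nat.split)
    have "fps_nth (fps_of_poly (map_poly of_int (Poly ?h))) n = (of_int (coeff (Poly ?h) n) :: rat)"
      by (simp only: fps_of_poly_nth coeff_map_poly of_int_0)
    then show "fps_nth (fps_of_poly (map_poly of_int (Poly ?h))) n = fps_nth ?N n"
      unfolding N h by simp
  qed
  moreover have "coeffs (Poly ?h) = ?h"
    using assms(1,2) by (simp add: strip_while_replicate)
  moreover have "krull_dim (mpoly_ring (edges (G_rd r d)) Quot I) = enat ?D"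
    unfolding assms(3) by (rule krull_dim_G_rd[OF assms(1) d])
  ultimately show "is_h_vector (edges (G_rd r d)) I ?h"
    unfolding is_h_vector_def using H by metis
qed

end
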